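(* Let $X$ be either an oriented circle or an oriented interval. Then any $1$-dimensional cut-diagram over $X$ is cut-concordant to the empty cut-diagram over $X$ (the one with no cut-points).
   Context: **1-dimensional cut-diagrams.** Let $X$ be a compact oriented $1$-manifold. A $1$-dimensional cut-diagram over $X$ is a finite collection of pairwise distinct points in the interior of $X$, called cut-points, each endowed with a sign $\pm$ and labeled by a region, where regions are the connected components of $X$ minus all cut-points. There is no constraint on the labeling. **2-dimensional cut-diagrams.** Let $\Sigma$ be a compact oriented surface, possibly with boundary. A diagram on $\Sigma$ is a compact oriented $1$-manifold $P$ generically (not necessarily properly) immersed in $\Sigma$, with over/under information at each transverse double point (crossing); endpoints of $P$ may lie in the interior of $\Sigma$ (univalent vertices) or on $\partial\Sigma$. Regions are the connected components of $\Sigma\setminus P$; cut-arcs are the pieces into which $P$ is split by cutting it at all under-passages. A $2$-dimensional cut-diagram over $\Sigma$ is a diagram on $\Sigma$ with each cut-arc labeled by a region such that: (1) at each crossing where the over cut-arc is labeled $C$, and where the under cut-arc lying on the left (resp. right) of the oriented over-arc is labeled $A$ (resp. $B$), the regions $A$ and $B$ are adjacent along some $C$-labeled cut-arc having $A$ on its left and $B$ on its right; (2) a cut-arc containing a univalent vertex interior to $\Sigma$ and lying in region $A$ is labeled by $A$. **Cut-concordance.** Two cut-diagrams $\mathcal C_0,\mathcal C_1$ over $X$ are cut-concordant if there is a $2$-dimensional cut-diagram $\mathcal C$ over $X\times[0,1]$ (product orientation), called a cut-concordance between them, and homeomorphisms $f_\varepsilon:(X,\mathcal C_\varepsilon)\to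 (X\times\{\varepsilon\},\mathcal C\cap(X\times\{\varepsilon\}))$, $\varepsilon\in\{0,1\}$, preserving orientation (and sending each component $X_i$ of $X$ to $X_i\times\{\varepsilon\}$), such that: (Orientation) a cut-point of $\mathcal C_0$ (resp. $\mathcal C_1$) is mapped to an inward-oriented endpoint of a cut-arc if and only if its sign is positive (resp. negative); (Labeling) if a cut-point $p$ of $\mathcal C_\varepsilon$ is labeled by the region $r$, then the cut-arc of $\mathcal C$ containing $f_\varepsilon(p)$ is labeled by the region of $\mathcal C$ containing $f_\varepsilon(r)$; and, if $\partial X\ne\emptyset$, $\mathcal C\cap(\partial X\times[0,1])\cong f_\varepsilon(\mathcal C_0\cap\partial X)\times[0,1]$ (since cut-points are interior to $X$, this says that $\mathcal C$ is disjoint from $\partial X\times[0,1]$). *)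

theory Defs
  imports "HOL-Complex_Analysis.Complex_Analysis"
begin

text \<open>
  Everything lives in the topological category. A space comes with an atlas of charts
  \<open>(U, \<phi>)\<close>, where \<open>\<phi>\<close> maps the open set \<open>U\<close> homeomorphically onto a nondegenerate interval of the
  line (dimension 1), or onto a product of two such intervals in the plane (dimension 2). The
  intervals need not be open, so boundary points, and the corners of \<open>X \<times> [0,1]\<close>, are covered.
\<close>

type_synonym ('a, 'm) chart = "'a set \<times> ('a \<Rightarrow> 'm)"

record ('a, 'm) charted =
  space_of :: "'a topology"
  atlas :: "('a, 'm) chart set"

abbreviation pts :: "('a, 'm) charted \<Rightarrow> 'a set" where
  "pts M \<equiv> topspace (space_of M)"

definition intervals :: "real set set" where
  "intervals = {I. is_interval I \<and> interior I \<noteq> {}}"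

definition rect :: "real set \<Rightarrow> real set \<Rightarrow> complex set" where
  "rect I J = {z. Re z \<in> I \<and> Im z \<in> J}"

definition rects :: "complex set set" where
  "rects = {rect I J | I J. I \<in> intervals \<and> J \<in> intervals}"

definition is_chart ::
  "'m::topological_space set set \<Rightarrow> ('a, 'm) charted \<Rightarrow> ('a, 'm) chart \<Rightarrow> bool" where
  "is_chart models M = (\<lambda>(U, \<phi>). openin (space_of M) U \<and> \<phi> ` U \<in> models \<and>
     homeomorphic_map (subtopology (space_of M) U) (top_of_set (\<phi> ` U)) \<phi>)"

text \<open>Two charts of a curve are compatible if the change of coordinates is locally increasing.\<close>

definition compatible1 :: "('a, real) charted \<Rightarrow> ('a, real) chart \<Rightarrow> ('a, real) chart \<Rightarrow> bool" where
  "compatible1 M = (\<lambda>(U, \<phi>) (V, \<psi>). \<forall>x \<in> U \<inter> V. \<exists>W. openin (space_of M) W \<and> x \<in> W \<and> W \<subseteq> U \<inter> V \<and>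
     (\<forall>y \<in> W. \<forall>z \<in> W. \<phi> y < \<phi> z \<longleftrightarrow> \<psi> y < \<psi> z))"

text \<open>
  Two charts of a surface are compatible if the change of coordinates has local degree \<open>+1\<close> at
  every interior point: it maps a small positively oriented circle around \<open>\<phi> x\<close> to a loop that winds
  once around \<open>\<psi> x\<close>.
\<close>

definition compatible2 :: "('a, complex) chart \<Rightarrow> ('a, complex) chart \<Rightarrow> bool" where
  "compatible2 = (\<lambda>(U, \<phi>) (V, \<psi>). \<forall>x \<in> U \<inter> V. \<forall>r > 0. cball (\<phi> x) r \<subseteq> \<phi> ` (U \<inter> V) \<longrightarrow>
     winding_number (\<psi> \<circ> inv_into U \<phi> \<circ> circlepath (\<phi> x) r) (\<psi> x) = 1)"

definition positive_chart1 :: "('a, real) charted \<Rightarrow> ('a, real) chart \<Rightarrow> bool" where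
  "positive_chart1 M c \<longleftrightarrow> is_chart intervals M c \<and> (\<forall>d \<in> atlas M. compatible1 M c d)"

definition positive_chart2 :: "('a, complex) charted \<Rightarrow> ('a, complex) chart \<Rightarrow> bool" where
  "positive_chart2 M c \<longleftrightarrow> is_chart rects M c \<and> (\<forall>d \<in> atlas M. compatible2 c d)"

text \<open>Second countability follows from compactness and the existence of charts.\<close>

definition compact_oriented_curve :: "('a, real) charted \<Rightarrow> bool" where
  "compact_oriented_curve M \<longleftrightarrow> compact_space (space_of M) \<and> Hausdorff_space (space_of M) \<and>
     (\<Union>c \<in> atlas M. fst c) = pts M \<and> (\<forall>c \<in> atlas M. positive_chart1 M c)"

definition compact_oriented_surface :: "('a, complex) charted \<Rightarrow> bool" where
  "compact_oriented_surface M \<longleftrightarrow> compact_space (space_of M) \<and> Hausdorff_space (space_of M) \<and>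
     (\<Union>c \<in> atlas M. fst c) = pts M \<and> (\<forall>c \<in> atlas M. positive_chart2 M c)"

definition bdry :: "('a, 'm::topological_space) charted \<Rightarrow> 'a set" where
  "bdry M = {x. \<exists>(U, \<phi>) \<in> atlas M. x \<in> U \<and> \<phi> x \<notin> interior (\<phi> ` U)}"

text \<open>The boundary points at which an oriented curve starts.\<close>

definition initial_pts :: "('a, real) charted \<Rightarrow> 'a set" where
  "initial_pts M = {x. \<exists>(U, \<phi>) \<in> atlas M. x \<in> U \<and> (\<forall>y \<in> U. \<phi> x \<le> \<phi> y)}"

text \<open>The cylinder \<open>X \<times> [0,1]\<close> with the product orientation.\<close>

definition cylinder :: "('a, real) charted \<Rightarrow> ('a \<times> real, complex) charted" where
  "cylinder X = \<lparr>space_of = prod_topology (space_of X) (top_of_set {0..1}),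
     atlas = {(U \<times> {0..1}, \<lambda>(x, t). Complex (\<phi> x) t) | U \<phi>. (U, \<phi>) \<in> atlas X}\<rparr>"

datatype sign = Pos | Neg

text \<open>The domain of the map is the set of cut-points; the values are the signs and labels.\<close>

type_synonym 'a cut_diagram1 = "'a \<rightharpoonup> sign \<times> 'a set"

definition regions1 :: "('a, real) charted \<Rightarrow> 'a cut_diagram1 \<Rightarrow> 'a set set" where
  "regions1 X C = connected_components_of (subtopology (space_of X) (pts X - dom C))"

definition is_cut_diagram1 :: "('a, real) charted \<Rightarrow> 'a cut_diagram1 \<Rightarrow> bool" where
  "is_cut_diagram1 X C \<longleftrightarrow> finite (dom C) \<and> dom C \<subseteq> pts X - bdry X \<and>
     (\<forall>p s r. C p = Some (s, r) \<longrightarrow> r \<in> regions1 X C)"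

text \<open>
  A diagram is given by an abstract compact oriented curve (\<open>strands\<close>), its immersion \<open>imm\<close> into the
  surface, and the set \<open>unders\<close> of those points of the curve that are under-passages.
  Cut-arcs are subsets of the abstract curve, since two cut-arcs may cross in the surface.
\<close>

record ('p, 'b) cut_diagram2 =
  strands :: "('p, real) charted"
  imm :: "'p \<Rightarrow> 'b"
  unders :: "'p set"
  label :: "'p set \<Rightarrow> 'b set"

definition diagram_set :: "('p, 'b) cut_diagram2 \<Rightarrow> 'b set" where
  "diagram_set D = imm D ` pts (strands D)"

definition preim :: "('p, 'b) cut_diagram2 \<Rightarrow> 'b set \<Rightarrow> 'p set" where
  "preim D U = {w \<in> pts (strands D). imm D w \<in> U}"

text \<open>
  Local model at a point that is not a crossing: in a positive chart, the diagram runs from left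
  to right along the real axis. The point is an interior point of the strand, its start, or its end,
  according to whether the strand covers \<open>(-1,1)\<close>, \<open>[0,1)\<close>, or \<open>(-1,0]\<close>. In the last two cases it
  lies either in the interior of the surface (\<open>U\<close> is a full square) or on its boundary (\<open>U\<close> is a
  half-square with edge orthogonal to the strand).
\<close>

definition arc_chart ::
  "('b, complex) charted \<Rightarrow> ('p, 'b) cut_diagram2 \<Rightarrow> 'p \<Rightarrow> ('b, complex) chart \<Rightarrow> bool" where
  "arc_chart S D p = (\<lambda>(U, \<phi>).
     positive_chart2 S (U, \<phi>) \<and> p \<in> preim D U \<and> \<phi> (imm D p) = 0 \<and>
     (\<forall>w \<in> preim D U. Im (\<phi> (imm D w)) = 0) \<and>
     positive_chart1 (strands D) (preim D U, \<lambda>w. Re (\<phi> (imm D w))) \<and>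
     (\<exists>I \<in> {{-1<..<1}, {0..<1}, {-1<..0}}.
        (\<lambda>w. Re (\<phi> (imm D w))) ` preim D U = I \<and>
        (\<phi> ` U = rect {-1<..<1} {-1<..<1} \<or> \<phi> ` U = rect I {-1<..<1})))"

text \<open>
  Local model at a crossing with over-passage \<open>p\<close> and under-passage \<open>q\<close>: in a positive chart, the
  over-strand \<open>V\<close> runs from left to right along the real axis, and the under-strand \<open>W\<close> runs upwards
  or downwards along the imaginary axis. So the upper half is on the left of the over-strand.
\<close>

definition crossing_chart ::
  "('b, complex) charted \<Rightarrow> ('p, 'b) cut_diagram2 \<Rightarrow> 'p \<Rightarrow> 'p \<Rightarrow> 'p set \<Rightarrow> 'p set \<Rightarrow>
   ('b, complex) chart \<Rightarrow> bool" where
  "crossing_chart S D p q V W = (\<lambda>(U, \<phi>).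
     positive_chart2 S (U, \<phi>) \<and> \<phi> ` U = rect {-1<..<1} {-1<..<1} \<and>
     preim D U = V \<union> W \<and> V \<inter> W = {} \<and> p \<in> V \<and> q \<in> W \<and>
     \<phi> (imm D p) = 0 \<and> \<phi> (imm D q) = 0 \<and>
     V \<inter> unders D = {} \<and> W \<inter> unders D = {q} \<and>
     (\<forall>w \<in> V. Im (\<phi> (imm D w)) = 0) \<and>
     (\<lambda>w. Re (\<phi> (imm D w))) ` V = {-1<..<1} \<and>
     positive_chart1 (strands D) (V, \<lambda>w. Re (\<phi> (imm D w))) \<and>
     (\<forall>w \<in> W. Re (\<phi> (imm D w)) = 0) \<and>
     (\<lambda>w. Im (\<phi> (imm D w))) ` W = {-1<..<1} \<and>
     (positive_chart1 (strands D) (W, \<lambda>w. Im (\<phi> (imm D w))) \<or>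
      positive_chart1 (strands D) (W, \<lambda>w. - Im (\<phi> (imm D w)))))"

definition is_diagram :: "('b, complex) charted \<Rightarrow> ('p, 'b) cut_diagram2 \<Rightarrow> bool" where
  "is_diagram S D \<longleftrightarrow> compact_oriented_surface S \<and> compact_oriented_curve (strands D) \<and>
     unders D \<subseteq> pts (strands D) \<and>
     (\<forall>p \<in> pts (strands D).
        (p \<notin> unders D \<and> (\<exists>c. arc_chart S D p c)) \<or>
        (\<exists>q V W c. crossing_chart S D p q V W c) \<or>
        (\<exists>q V W c. crossing_chart S D q p V W c))"

definition regions2 :: "('b, complex) charted \<Rightarrow> ('p, 'b) cut_diagram2 \<Rightarrow> 'b set set" where
  "regions2 S D = connected_components_of (subtopology (space_of S) (pts S - diagram_set D))"

definition cut_arcs :: "('p, 'b) cut_diagram2 \<Rightarrow> 'p set set" where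
  "cut_arcs D =
     connected_components_of (subtopology (space_of (strands D)) (pts (strands D) - unders D))"

text \<open>
  Since a cut-arc may pass over other ones, the regions next to it can change along the cut-arc;
  it suffices that \<open>A\<close> (on the left) and \<open>B\<close> (on the right) meet at some point of it.
\<close>

definition adjacent_along ::
  "('b, complex) charted \<Rightarrow> ('p, 'b) cut_diagram2 \<Rightarrow> 'p set \<Rightarrow> 'b set \<Rightarrow> 'b set \<Rightarrow> bool" where
  "adjacent_along S D c A B \<longleftrightarrow> (\<exists>p \<in> c. \<exists>U \<phi>. arc_chart S D p (U, \<phi>) \<and>
     (\<lambda>w. Re (\<phi> (imm D w))) ` preim D U = {-1<..<1} \<and>
     {y \<in> U. Im (\<phi> y) > 0} \<subseteq> A \<and> {y \<in> U. Im (\<phi> y) < 0} \<subseteq> B)"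

definition crossing_condition :: "('b, complex) charted \<Rightarrow> ('p, 'b) cut_diagram2 \<Rightarrow> bool" where
  "crossing_condition S D \<longleftrightarrow> (\<forall>p q V W U \<phi>. crossing_chart S D p q V W (U, \<phi>) \<longrightarrow>
     (\<forall>over \<in> cut_arcs D. \<forall>left \<in> cut_arcs D. \<forall>right \<in> cut_arcs D.
        p \<in> over \<and> {w \<in> W. Im (\<phi> (imm D w)) > 0} \<subseteq> left \<and>
        {w \<in> W. Im (\<phi> (imm D w)) < 0} \<subseteq> right \<longrightarrow>
        (\<exists>c \<in> cut_arcs D. label D c = label D over \<and>
           adjacent_along S D c (label D left) (label D right))))"

text \<open>
  A univalent vertex in the interior of the surface is itself a point of the diagram; the region it
  lies in is the unique region having it in its closure.
\<close>

definition endpoint_condition :: "('b, complex) charted \<Rightarrow> ('p, 'b) cut_diagram2 \<Rightarrow> bool" where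
  "endpoint_condition S D \<longleftrightarrow> (\<forall>c \<in> cut_arcs D. \<forall>p \<in> c \<inter> bdry (strands D). \<forall>A \<in> regions2 S D.
     imm D p \<notin> bdry S \<and> imm D p \<in> space_of S closure_of A \<longrightarrow> label D c = A)"

definition is_cut_diagram2 :: "('b, complex) charted \<Rightarrow> ('p, 'b) cut_diagram2 \<Rightarrow> bool" where
  "is_cut_diagram2 S D \<longleftrightarrow> is_diagram S D \<and>
     (\<forall>c \<in> cut_arcs D. label D c \<in> regions2 S D) \<and>
     crossing_condition S D \<and> endpoint_condition S D"

text \<open>
  \<open>f\<close> identifies \<open>(X, C)\<close> with the end \<open>X \<times> {e}\<close> of the cut-diagram \<open>D\<close> on the cylinder, where \<open>s\<close> is
  the sign of those cut-points that correspond to inward-oriented endpoints.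
\<close>

definition concordance_end :: "('a, real) charted \<Rightarrow> ('p, 'a \<times> real) cut_diagram2 \<Rightarrow>
    real \<Rightarrow> sign \<Rightarrow> 'a cut_diagram1 \<Rightarrow> ('a \<Rightarrow> 'a \<times> real) \<Rightarrow> bool" where
  "concordance_end X D e s C f \<longleftrightarrow>
     homeomorphic_map (space_of X) (subtopology (space_of (cylinder X)) (pts X \<times> {e})) f \<and>
     f ` dom C = diagram_set D \<inter> (pts X \<times> {e}) \<and>
     (\<forall>(U, \<phi>) \<in> atlas X. positive_chart1 X ({x \<in> pts X. fst (f x) \<in> U}, \<lambda>x. \<phi> (fst (f x)))) \<and>
     (\<forall>K \<in> connected_components_of (space_of X). f ` K = K \<times> {e}) \<and>
     (\<forall>x t r. \<forall>w \<in> pts (strands D). C x = Some (t, r) \<and> imm D w = f x \<longrightarrow>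
        (w \<in> initial_pts (strands D) \<longleftrightarrow> t = s) \<and>
        (\<forall>c \<in> cut_arcs D. w \<in> c \<longrightarrow> f ` r \<subseteq> label D c))"

text \<open>
  The abstract curve underlying the concordance is carried by a set of complex numbers. This is no
  restriction: every compact curve is a finite disjoint union of circles and intervals, hence embeds
  into the plane.
\<close>

definition cut_concordant ::
  "('a, real) charted \<Rightarrow> 'a cut_diagram1 \<Rightarrow> 'a cut_diagram1 \<Rightarrow> bool" where
  "cut_concordant X C0 C1 \<longleftrightarrow> is_cut_diagram1 X C0 \<and> is_cut_diagram1 X C1 \<and>
     (\<exists>(D :: (complex, 'a \<times> real) cut_diagram2) f0 f1.
        is_cut_diagram2 (cylinder X) D \<and>
        concordance_end X D 0 Pos C0 f0 \<and> concordance_end X D 1 Neg C1 f1 \<and>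
        diagram_set D \<inter> (bdry X \<times> {0..1}) = {})"

end

theory Submission
  imports Defs
begin

text \<open>
  Over every cut-point \<open>p\<close> erect the vertical stub \<open>{p} \<times> [0,1/2]\<close>, oriented according to the sign of
  \<open>p\<close>. The stubs are disjoint and do not separate the cylinder, so there are no crossings and only
  one region. Hence all labels are forced to agree, and every labeling of the cut-points is
  respected.
\<close>

section \<open>Winding numbers\<close>

text \<open>Most of the work goes into orientations. A change of coordinates on a surface is only
  continuous, so its sign is tested by winding numbers of images of circles; and the local model of
  an arc is horizontal and runs to the right, whereas a stub is vertical and runs up or down. All
  charts of the cylinder are therefore taken from one family,
  \<open>u * Complex (\<phi> x) ((t - t0) / \<delta>)\<close>: a chart of the curve times a rescaled
  height, followed by a turn \<open>u\<close> in \<open>{1, \<i>, -\<i>}\<close>. Once the turn is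
  undone, passing to an atlas chart acts on the two coordinates separately and increases both, and
  this forces winding number 1. The height 1/2 stands for any value strictly between 0 and 1. Being
  less than 1, it keeps the top end free of cut-points and leaves a slab through which all of the
  complement is joined. The upper end of a stub is then a univalent vertex in the interior, which
  forces the label of the stub; that label must also contain the prescribed region at the bottom,
  and a single region meets both demands.\<close>

text \<open>Vectors with positive inner product are never opposite, so the straight homotopy from
  \<open>g\<close> to the turned unit circle \<open>h\<close> avoids \<open>w\<close>. A second
  straight homotopy leads from \<open>h\<close> to the standard circle; it avoids \<open>w\<close>
  because 1 and \<open>u\<close> are not opposite, hence the absence of -1 among the values of
  \<open>u\<close>.\<close>

lemma winding_number_eq_1_if_inner_pos:
  fixes g :: "real \<Rightarrow> complex" and u w :: complex
  assumes u: "u \<in> {1, \<i>, -\<i>}" and g: "path g" "pathfinish g = pathstart g"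
    and pos: "\<And>t. t \<in> {0..1} \<Longrightarrow> 0 < Re ((g t - w) * cnj (u * exp (2 * of_real pi * \<i> * t)))"
  shows "winding_number g w = 1"
proof -
  define e :: "real \<Rightarrow> complex" where "e t = exp (2 * of_real pi * \<i> * t)" for t
  have e0: "e t \<noteq> 0" for t by (simp add: e_def)
  define h where "h t = w + u * e t" for t
  have ce: "circlepath w 1 = (\<lambda>t. w + e t)" by (auto simp: circlepath e_def)
  have h: "path h" "pathfinish h = pathstart h"
    unfolding path_def h_def e_def pathfinish_def pathstart_def
    by (auto intro!: continuous_intros)
  have "winding_number h w = winding_number g w"
  proof (rule winding_number_loops_linear_eq[OF g(1) h(1) g(2) h(2)])
    fix t :: real assume t: "t \<in> {0..1}"
    let ?a = "g t - w" and ?b = "u * e t"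
    show "w \<notin> closed_segment (g t) (h t)"
    proof
      assume "w \<in> closed_segment (g t) (h t)"
      then obtain s where s: "0 \<le> s" "s \<le> 1" "w = (1 - s) *\<^sub>R g t + s *\<^sub>R h t"
        unfolding closed_segment_def by auto
      have "(1 - s) *\<^sub>R ?a + s *\<^sub>R ?b = 0"
        using s(3) by (simp add: h_def algebra_simps scaleR_conv_of_real)
      \<comment> \<open>Pairing the vanishing combination with \<open>?b\<close> turns it into a
        convex combination of two positive numbers, which cannot vanish.\<close>
      then have "Re (((1 - s) *\<^sub>R ?a + s *\<^sub>R ?b) * cnj ?b) = 0" by simp
      moreover have "((1 - s) *\<^sub>R ?a + s *\<^sub>R ?b) * cnj ?b
          = (1 - s) *\<^sub>R (?a * cnj ?b) + s *\<^sub>R (?b * cnj ?b)"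
        by (simp add: algebra_simps scaleR_conv_of_real)
      moreover have "?b * cnj ?b = of_real ((norm ?b)\<^sup>2)"
        by (metis complex_norm_square)
      ultimately have *: "(1 - s) * Re (?a * cnj ?b) + s * (norm ?b)\<^sup>2 = 0"
        by (metis Re_complex_of_real plus_complex.sel(1) scaleR_complex.sel(1))
      have A: "0 < Re (?a * cnj ?b)" using pos[OF t] by (simp only: e_def)
      have B: "0 < (norm ?b)\<^sup>2" using u e0[of t] by auto
      have "0 \<le> (1 - s) * Re (?a * cnj ?b)" "0 \<le> s * (norm ?b)\<^sup>2"
        using s(1,2) A B by (auto intro: mult_nonneg_nonneg)
      with * have "(1 - s) * Re (?a * cnj ?b) = 0" "s * (norm ?b)\<^sup>2 = 0" by linarith+
      with A B have "1 - s = 0" "s = 0" by auto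
      then show False by simp
    qed
  qed
  moreover have "winding_number h w = winding_number (circlepath w 1) w"
  proof (rule winding_number_loops_linear_eq)
    fix t :: real
    show "w \<notin> closed_segment (circlepath w 1 t) (h t)"
    proof
      assume "w \<in> closed_segment (circlepath w 1 t) (h t)"
      then obtain s where s: "0 \<le> s" "s \<le> 1" "w = (1 - s) *\<^sub>R (w + e t) + s *\<^sub>R h t"
        unfolding closed_segment_def ce by auto
      have "(of_real (1 - s) + of_real s * u) * e t = 0"
        using s(3) by (simp add: h_def algebra_simps scaleR_conv_of_real)
      then have "of_real (1 - s) + of_real s * u = 0" using e0 by simp
      then show False using u by (auto simp: complex_eq_iff)
    qed
  qed (use h in auto)
  ultimately show ?thesis by (simp add: winding_number_circlepath_centre)
qed

section \<open>Charts\<close>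

lemma intervals_iff: "I \<in> intervals \<longleftrightarrow> is_interval I \<and> (\<exists>a\<in>I. \<exists>b\<in>I. a < b)"
proof -
  have "interior I \<noteq> {} \<longleftrightarrow> (\<exists>a\<in>I. \<exists>b\<in>I. a < b)" if I: "is_interval I"
  proof
    assume "interior I \<noteq> {}"
    then obtain x e where "e > 0" "ball x e \<subseteq> I"
      by (meson equals0I mem_interior)
    moreover have "x \<in> ball x e" "x + e/2 \<in> ball x e" "x < x + e/2"
      using \<open>e > 0\<close> by (auto simp: dist_real_def)
    ultimately show "\<exists>a\<in>I. \<exists>b\<in>I. a < b" by blast
  next
    assume "\<exists>a\<in>I. \<exists>b\<in>I. a < b"
    then obtain a b where ab: "a \<in> I" "b \<in> I" "a < b" by blast
    then have "{a..b} \<subseteq> I" using I interval_subset_is_interval[of I a b] by simp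
    then have "{a<..<b} \<subseteq> I" using greaterThanLessThan_subseteq_atLeastAtMost_iff[of a b a b] by blast
    then have "{a<..<b} \<subseteq> interior I" by (simp add: interior_maximal)
    then show "interior I \<noteq> {}" using dense[OF ab(3)] by auto
  qed
  then show ?thesis by (auto simp: intervals_def)
qed

lemma affine_image_intervals:
  fixes c d :: real
  assumes "I \<in> intervals" "c \<noteq> 0"
  shows "(\<lambda>x. c * x + d) ` I \<in> intervals"
proof -
  have "is_interval ((\<lambda>x. c * x + d) ` I)"
    using assms unfolding is_interval_connected_1 intervals_def
    by (auto intro!: connected_continuous_image continuous_intros)
  moreover obtain a b where ab: "a \<in> I" "b \<in> I" "a < b"
    using assms by (auto simp: intervals_iff)
  have "c * a + d < c * b + d \<or> c * b + d < c * a + d" using ab(3) assms(2)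
    by (metis add_less_cancel_right mult_less_cancel_left_neg mult_less_cancel_left_pos
          linorder_neqE_linordered_idom)
  ultimately show ?thesis using ab unfolding intervals_iff by blast
qed

lemma is_chartI:
  assumes "openin (space_of M) U" "\<phi> ` U \<in> models"
    and "continuous_map (subtopology (space_of M) U) euclidean \<phi>"
    and "continuous_map (top_of_set (\<phi> ` U)) (space_of M) g" "\<And>x. x \<in> U \<Longrightarrow> g (\<phi> x) = x"
  shows "is_chart models M (U, \<phi>)"
proof -
  have "U \<subseteq> pts M" using assms(1) by (rule openin_subset)
  then have "homeomorphic_maps (subtopology (space_of M) U) (top_of_set (\<phi> ` U)) \<phi> g"
    unfolding homeomorphic_maps_def continuous_map_in_subtopology using assms
    by (auto simp: continuous_map_in_subtopology)
  then show ?thesis using assms(1,2) unfolding is_chart_def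
    by (auto simp: homeomorphic_map_maps)
qed

lemma is_chartD:
  assumes "is_chart models M (U, \<phi>)"
  shows "openin (space_of M) U" "U \<subseteq> pts M" "\<phi> ` U \<in> models" "inj_on \<phi> U"
    and "continuous_map (subtopology (space_of M) U) euclidean \<phi>"
    and "continuous_map (top_of_set (\<phi> ` U)) (subtopology (space_of M) U) (inv_into U \<phi>)"
proof -
  show o: "openin (space_of M) U" "\<phi> ` U \<in> models" using assms by (auto simp: is_chart_def)
  show U: "U \<subseteq> pts M" using o(1) by (rule openin_subset)
  have h: "homeomorphic_map (subtopology (space_of M) U) (top_of_set (\<phi> ` U)) \<phi>"
    using assms by (auto simp: is_chart_def)
  have t: "topspace (subtopology (space_of M) U) = U" using U by auto
  show i: "inj_on \<phi> U" using homeomorphic_imp_injective_map[OF h] t by simp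
  show "continuous_map (subtopology (space_of M) U) euclidean \<phi>"
    using homeomorphic_imp_continuous_map[OF h] by (simp add: continuous_map_in_subtopology)
  obtain g where g: "homeomorphic_maps (subtopology (space_of M) U) (top_of_set (\<phi> ` U)) \<phi> g"
    using h by (auto simp: homeomorphic_map_maps)
  then have "continuous_map (top_of_set (\<phi> ` U)) (subtopology (space_of M) U) g"
    and "\<And>x. x \<in> U \<Longrightarrow> g (\<phi> x) = x"
    using U by (auto simp: homeomorphic_maps_def)
  with i show "continuous_map (top_of_set (\<phi> ` U)) (subtopology (space_of M) U) (inv_into U \<phi>)"
    by (elim continuous_map_eq) auto
qed

lemma is_chart_restrict_affine:
  fixes \<phi> :: "'a \<Rightarrow> real"
  assumes ch: "is_chart models M (U, \<phi>)" and c: "c \<noteq> 0"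
    and J: "J \<in> intervals" "openin (top_of_set (\<phi> ` U)) J"
  shows "is_chart intervals M ({x \<in> U. \<phi> x \<in> J}, \<lambda>x. c * \<phi> x + d)"
proof -
  note D = is_chartD[OF ch]
  let ?N = "{x \<in> U. \<phi> x \<in> J}"
  have JU: "J \<subseteq> \<phi> ` U" using J(2) openin_imp_subset by blast
  have im: "\<phi> ` ?N = J" using JU by blast
  have im': "(\<lambda>x. c * \<phi> x + d) ` ?N = (\<lambda>x. c * x + d) ` J"
    by (subst im[symmetric]) (simp add: image_image)
  show ?thesis
  proof (rule is_chartI)
    have "openin (subtopology (space_of M) U) {x \<in> topspace (subtopology (space_of M) U). \<phi> x \<in> J}"
      using D(5) J(2) D(2)
      by (intro openin_continuous_map_preimage[of _ "top_of_set (\<phi> ` U)"])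
         (auto simp: continuous_map_in_subtopology)
    moreover have "{x \<in> topspace (subtopology (space_of M) U). \<phi> x \<in> J} = ?N" using D(2) by auto
    ultimately show "openin (space_of M) ?N"
      using D(1) openin_trans_full by (metis (no_types, lifting))
    show "(\<lambda>x. c * \<phi> x + d) ` ?N \<in> intervals"
      unfolding im' using J(1) c by (rule affine_image_intervals)
    have "continuous_map (subtopology (space_of M) ?N) euclidean \<phi>"
      by (rule continuous_map_from_subtopology_mono[OF D(5)]) auto
    then show "continuous_map (subtopology (space_of M) ?N) euclidean (\<lambda>x. c * \<phi> x + d)"
      by (intro continuous_intros) auto
    have "continuous_map (top_of_set ((\<lambda>x. c * x + d) ` J)) (top_of_set (\<phi> ` U)) (\<lambda>y. (y - d) / c)"
      unfolding continuous_map_in_subtopology using JU c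
      by (auto intro!: continuous_intros simp: image_subset_iff)
    from continuous_map_compose[OF this D(6)]
    show "continuous_map (top_of_set ((\<lambda>x. c * \<phi> x + d) ` ?N)) (space_of M)
            (inv_into U \<phi> \<circ> (\<lambda>y. (y - d) / c))"
      unfolding im' by (simp add: continuous_map_in_subtopology)
    show "(inv_into U \<phi> \<circ> (\<lambda>y. (y - d) / c)) (c * \<phi> x + d) = x" if "x \<in> ?N" for x
      using that c D(4) by simp
  qed
qed

lemma compatible1_restrict_affine:
  assumes "compatible1 M (U, \<phi>) (V, \<psi>)" and c: "c > 0"
    and N: "openin (space_of M) N" "N \<subseteq> U"
  shows "compatible1 M (N, \<lambda>x. c * \<phi> x + d) (V, \<psi>)"
  unfolding compatible1_def prod.case
proof
  fix x assume "x \<in> N \<inter> V"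
  then obtain W where "openin (space_of M) W" "x \<in> W" "W \<subseteq> U \<inter> V"
      and "\<forall>y\<in>W. \<forall>z\<in>W. \<phi> y < \<phi> z \<longleftrightarrow> \<psi> y < \<psi> z"
    using assms(1) N(2) unfolding compatible1_def by blast
  then show "\<exists>W. openin (space_of M) W \<and> x \<in> W \<and> W \<subseteq> N \<inter> V \<and>
      (\<forall>y\<in>W. \<forall>z\<in>W. (c * \<phi> y + d < c * \<phi> z + d) = (\<psi> y < \<psi> z))"
    using N(1) \<open>x \<in> N \<inter> V\<close> c by (intro exI[of _ "W \<inter> N"]) auto
qed

lemma positive_chart1_restrict_affine:
  assumes "positive_chart1 M (U, \<phi>)" and "c > 0"
    and "J \<in> intervals" "openin (top_of_set (\<phi> ` U)) J"
  shows "positive_chart1 M ({x \<in> U. \<phi> x \<in> J}, \<lambda>x. c * \<phi> x + d)"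
proof -
  have "is_chart intervals M ({x \<in> U. \<phi> x \<in> J}, \<lambda>x. c * \<phi> x + d)"
    using assms by (intro is_chart_restrict_affine) (auto simp: positive_chart1_def)
  moreover from is_chartD(1)[OF this] assms(1,2)
  have "compatible1 M ({x \<in> U. \<phi> x \<in> J}, \<lambda>x. c * \<phi> x + d) (V, \<psi>)" if "(V, \<psi>) \<in> atlas M" for V \<psi>
    using that by (intro compatible1_restrict_affine[of M U \<phi>]) (auto simp: positive_chart1_def)
  ultimately show ?thesis by (auto simp: positive_chart1_def)
qed

lemma positive_chart1_in_atlas:
  "compact_oriented_curve X \<Longrightarrow> c \<in> atlas X \<Longrightarrow> positive_chart1 X c"
  by (simp add: compact_oriented_curve_def)

lemma continuous_on_transition:
  assumes "is_chart models M (U, \<phi>)" "is_chart models' M (V, \<psi>)"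
  shows "continuous_on (\<phi> ` (U \<inter> V)) (\<psi> \<circ> inv_into U \<phi>)"
proof -
  note D = is_chartD[OF assms(1)]
  have "continuous_map (top_of_set (\<phi> ` (U \<inter> V))) (subtopology (space_of M) U) (inv_into U \<phi>)"
    by (rule continuous_map_from_subtopology_mono[OF D(6)]) auto
  moreover have "inv_into U \<phi> ` (\<phi> ` (U \<inter> V)) \<subseteq> V" using D(4) by auto
  ultimately have "continuous_map (top_of_set (\<phi> ` (U \<inter> V))) (subtopology (space_of M) V) (inv_into U \<phi>)"
    by (auto simp: continuous_map_in_subtopology)
  from continuous_map_compose[OF this is_chartD(5)[OF assms(2)]] show ?thesis by simp
qed

text \<open>Compatibility gives monotonicity only near each point. If \<open>\<psi>\<close> did not
  increase from \<open>x\<close> to \<open>y\<close>, it would first rise just after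
  \<open>x\<close> and then, by the intermediate value theorem, return to the value
  \<open>\<psi> x\<close>, against injectivity of \<open>\<psi>\<close>. The argument needs the
  whole coordinate interval between \<open>x\<close> and \<open>y\<close> to lie in the
  overlap.\<close>

lemma transition_less:
  assumes ch: "is_chart intervals M (U, \<phi>)" "is_chart intervals M (V, \<psi>)"
    and comp: "compatible1 M (U, \<phi>) (V, \<psi>)"
    and xy: "x \<in> U \<inter> V" "y \<in> U \<inter> V" "{\<phi> x..\<phi> y} \<subseteq> \<phi> ` (U \<inter> V)" "\<phi> x < \<phi> y"
  shows "\<psi> x < \<psi> y"
proof (rule ccontr)
  assume "\<not> \<psi> x < \<psi> y"
  note D = is_chartD[OF ch(1)] and E = is_chartD[OF ch(2)]
  define h where "h = \<psi> \<circ> inv_into U \<phi>"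
  have h: "h (\<phi> z) = \<psi> z" if "z \<in> U" for z using D(4) that by (simp add: h_def)
  have cont: "continuous_on {\<phi> x..\<phi> y} h"
    using continuous_on_transition[OF ch] xy(3) unfolding h_def by (rule continuous_on_subset)
  obtain W where W: "openin (space_of M) W" "x \<in> W" "W \<subseteq> U \<inter> V"
      "\<forall>y\<in>W. \<forall>z\<in>W. \<phi> y < \<phi> z \<longleftrightarrow> \<psi> y < \<psi> z"
    using comp xy(1) unfolding compatible1_def by blast
  have "homeomorphic_map (subtopology (space_of M) U) (top_of_set (\<phi> ` U)) \<phi>"
    using ch(1) by (simp add: is_chart_def)
  then have "open_map (subtopology (space_of M) U) (top_of_set (\<phi> ` U)) \<phi>"
    by (rule homeomorphic_imp_open_map)
  moreover have "openin (subtopology (space_of M) U) W"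
    using W(1,3) by (metis Int_subset_iff inf.absorb_iff1 openin_subtopology_Int)
  ultimately have "openin (top_of_set (\<phi> ` U)) (\<phi> ` W)" by (simp add: open_map_def)
  then obtain e where e: "e > 0" "ball (\<phi> x) e \<inter> \<phi> ` U \<subseteq> \<phi> ` W"
    using W(2) unfolding openin_contains_ball by blast
  \<comment> \<open>A coordinate to the right of \<open>\<phi> x\<close>, close enough to lie in the
    image of \<open>W\<close> and not beyond \<open>\<phi> y\<close>; here the local increase
    applies.\<close>
  define s where "s = min (\<phi> x + e/2) (\<phi> y)"
  have s: "\<phi> x < s" "s \<le> \<phi> y" "s \<in> ball (\<phi> x) e"
    using e(1) xy(4) by (auto simp: s_def dist_real_def min_def)
  then have "s \<in> {\<phi> x..\<phi> y}" by simp
  then have "s \<in> \<phi> ` U" using xy(3) by blast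
  then obtain z where z: "z \<in> W" "s = \<phi> z" using s(3) e(2) by auto
  have "h (\<phi> x) < h s" using W z s(1) h xy(1) by (metis IntD1 subsetD)
  moreover have "h (\<phi> y) \<le> h (\<phi> x)" using \<open>\<not> \<psi> x < \<psi> y\<close> h xy(1,2) by auto
  ultimately obtain v where v: "s \<le> v" "v \<le> \<phi> y" "h v = h (\<phi> x)"
    using IVT2'[of h "\<phi> y" "h (\<phi> x)" s] s continuous_on_subset[OF cont, of "{s..\<phi> y}"] by auto
  then have "v \<in> {\<phi> x..\<phi> y}" using s(1) by simp
  then obtain q where "q \<in> U \<inter> V" "v = \<phi> q" using xy(3) by blast
  then have "\<psi> q = \<psi> x" using v h xy(1) by auto
  then have "q = x" using E(4) \<open>q \<in> U \<inter> V\<close> xy(1) by (auto dest: inj_onD)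
  then show False using v s(1) \<open>v = \<phi> q\<close> by simp
qed

section \<open>The cylinder\<close>

lemma pts_cylinder [simp]: "pts (cylinder X) = pts X \<times> {0..1}"
  by (simp add: cylinder_def)

text \<open>Quarter turns permute the coordinate axes up to sign, so a product of intervals stays
  one, with factors possibly swapped or reflected. Multiplication by \<open>cnj u\<close> undoes the
  turn and makes membership readable.\<close>

lemma rects_rotate:
  assumes u: "u \<in> {1, \<i>, -\<i>}" and I: "I \<in> intervals" and J: "J \<in> intervals"
  shows "(\<lambda>(x, y). u * Complex x y) ` (I \<times> J) \<in> rects"
proof -
  have neg: "uminus ` K \<in> intervals" if "K \<in> intervals" for K :: "real set"
    using affine_image_intervals[OF that, of "-1" 0] by simp
  have *: "z \<in> (\<lambda>(x, y). u * Complex x y) ` (I \<times> J) \<longleftrightarrow>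
      Re (cnj u * z) \<in> I \<and> Im (cnj u * z) \<in> J" for z
  proof
    assume "z \<in> (\<lambda>(x, y). u * Complex x y) ` (I \<times> J)"
    then show "Re (cnj u * z) \<in> I \<and> Im (cnj u * z) \<in> J" using u by auto
  next
    assume a: "Re (cnj u * z) \<in> I \<and> Im (cnj u * z) \<in> J"
    have "z = u * Complex (Re (cnj u * z)) (Im (cnj u * z))"
      using u by (auto simp: complex_eq_iff)
    with a show "z \<in> (\<lambda>(x, y). u * Complex x y) ` (I \<times> J)" by force
  qed
  have m: "- a \<in> K \<longleftrightarrow> a \<in> uminus ` K" for a :: real and K by force
  consider "u = 1" | "u = \<i>" | "u = -\<i>" using u by blast
  then show ?thesis
  proof cases
    case 1
    then have "(\<lambda>(x, y). u * Complex x y) ` (I \<times> J) = rect I J"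
      unfolding set_eq_iff * rect_def by simp
    then show ?thesis using I J unfolding rects_def by blast
  next
    case 2
    then have "(\<lambda>(x, y). u * Complex x y) ` (I \<times> J) = rect (uminus ` J) I"
      unfolding set_eq_iff * rect_def by (auto simp: m)
    then show ?thesis using I neg[OF J] unfolding rects_def by blast
  next
    case 3
    then have "(\<lambda>(x, y). u * Complex x y) ` (I \<times> J) = rect J (uminus ` I)"
      unfolding set_eq_iff * rect_def by (auto simp: m)
    then show ?thesis using J neg[OF I] unfolding rects_def by blast
  qed
qed

text \<open>One form serves two purposes. With \<open>u = 1\<close>, \<open>t0 = 0\<close>,
  \<open>\<delta> = 1\<close> and \<open>J = {0..1}\<close> it is the atlas chart of the cylinder;
  other values give the windows in which a vertical stub takes the shape of the local model. The
  inverse reads both coordinates off \<open>cnj u * z\<close>.\<close>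

lemma is_chart_cylinder:
  assumes ch: "is_chart intervals X (U, \<phi>)"
    and J: "J \<in> intervals" "openin (top_of_set {0..1}) J"
    and \<delta>: "0 < \<delta>" and u: "u \<in> {1, \<i>, -\<i>}"
  shows "is_chart rects (cylinder X) (U \<times> J, \<lambda>(x, t). u * Complex (\<phi> x) ((t - t0) / \<delta>))"
    (is "is_chart _ _ (_, ?\<Phi>)")
proof -
  note D = is_chartD[OF ch]
  have uu: "cnj u * (u * z) = z" for z using u by auto
  have JI: "J \<subseteq> {0..1}" using J(2) openin_imp_subset by blast
  let ?g = "\<lambda>z. (inv_into U \<phi> (Re (cnj u * z)), t0 + \<delta> * Im (cnj u * z))"
  show ?thesis
  proof (rule is_chartI[where g = ?g])
    show "openin (space_of (cylinder X)) (U \<times> J)"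
      using D(1) J(2) by (simp add: cylinder_def openin_prod_Times_iff)
    have "?\<Phi> ` (U \<times> J) = (\<lambda>(x, y). u * Complex x y) ` (\<phi> ` U \<times> (\<lambda>t. (1/\<delta>) * t + (- t0 / \<delta>)) ` J)"
      by (force simp: image_iff diff_divide_distrib)
    then show "?\<Phi> ` (U \<times> J) \<in> rects"
      using rects_rotate[OF u D(3) affine_image_intervals[OF J(1), of "1/\<delta>" "- t0 / \<delta>"]] \<delta> by simp
    have top: "subtopology (space_of (cylinder X)) (U \<times> J)
        = prod_topology (subtopology (space_of X) U) (top_of_set J)"
      using JI by (simp add: cylinder_def subtopology_Times subtopology_subtopology inf.absorb2)
    have "continuous_map (prod_topology (subtopology (space_of X) U) (top_of_set J))
        euclidean (\<lambda>(x, t). (\<phi> x, t))"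
      unfolding prod_topology_euclidean[symmetric] continuous_map_pairwise o_def case_prod_unfold fst_conv snd_conv
      using continuous_map_compose[OF continuous_map_fst D(5), of "top_of_set J"]
        continuous_map_snd[of "subtopology (space_of X) U" "top_of_set J"]
      by (auto simp: o_def continuous_map_in_subtopology)
    moreover have "continuous_map euclidean euclidean
        (\<lambda>p::real \<times> real. u * Complex (fst p) ((snd p - t0) / \<delta>))"
      using \<delta> by (simp add: Complex_eq) (intro continuous_intros, auto)
    ultimately have "continuous_map (prod_topology (subtopology (space_of X) U) (top_of_set J)) euclidean
        ((\<lambda>p. u * Complex (fst p) ((snd p - t0) / \<delta>)) \<circ> (\<lambda>(x, t). (\<phi> x, t)))"
      by (rule continuous_map_compose)
    then show "continuous_map (subtopology (space_of (cylinder X)) (U \<times> J)) euclidean ?\<Phi>"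
      unfolding top by (rule continuous_map_eq) auto
    have reim: "Re (cnj u * ?\<Phi> p) = \<phi> (fst p)" "Im (cnj u * ?\<Phi> p) = (snd p - t0) / \<delta>" for p
      by (simp_all only: case_prod_unfold uu complex.sel)
    have "continuous_map (top_of_set (?\<Phi> ` (U \<times> J))) (top_of_set (\<phi> ` U)) (\<lambda>z. Re (cnj u * z))"
      unfolding continuous_map_in_subtopology continuous_map_iff_continuous image_subset_iff_funcset[symmetric]
        topspace_euclidean_subtopology
    proof (intro conjI)
      show "(\<lambda>z. Re (cnj u * z)) ` (?\<Phi> ` (U \<times> J)) \<subseteq> \<phi> ` U"
        unfolding image_image reim by auto
    qed (intro continuous_intros)
    from continuous_map_compose[OF this D(6)]
    have "continuous_map (top_of_set (?\<Phi> ` (U \<times> J))) (space_of X) (\<lambda>z. inv_into U \<phi> (Re (cnj u * z)))"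
      by (simp add: continuous_map_in_subtopology o_def)
    moreover have "continuous_map (top_of_set (?\<Phi> ` (U \<times> J))) (top_of_set {0..1})
        (\<lambda>z. t0 + \<delta> * Im (cnj u * z))"
      unfolding continuous_map_in_subtopology continuous_map_iff_continuous image_subset_iff_funcset[symmetric]
        topspace_euclidean_subtopology
    proof (intro conjI)
      show "(\<lambda>z. t0 + \<delta> * Im (cnj u * z)) ` (?\<Phi> ` (U \<times> J)) \<subseteq> {0..1}"
        unfolding image_image reim using \<delta> JI by auto
    qed (intro continuous_intros)
    ultimately show "continuous_map (top_of_set (?\<Phi> ` (U \<times> J))) (space_of (cylinder X)) ?g"
      by (simp add: cylinder_def continuous_map_pairwise o_def)
    show "?g (?\<Phi> p) = p" if "p \<in> U \<times> J" for p
      unfolding reim using that \<delta> D(4) by auto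
  qed
qed

text \<open>Up to the turn \<open>u\<close>, the change of coordinates is increasing in the curve
  direction and affine increasing in the height. So the displacement of the image loop from
  \<open>\<Psi> p\<close> has, coordinate by coordinate, the same sign as the displacement on the
  original circle turned back by \<open>cnj u\<close>, and their inner product is positive.\<close>

lemma compatible2_cylinder:
  assumes ch: "is_chart intervals X (U, \<phi>)" "is_chart intervals X (V, \<psi>)"
    and comp: "compatible1 X (U, \<phi>) (V, \<psi>)"
    and J: "J \<in> intervals" "openin (top_of_set {0..1}) J"
    and \<delta>: "0 < \<delta>" and u: "u \<in> {1, \<i>, -\<i>}"
  shows "compatible2 (U \<times> J, \<lambda>(x, t). u * Complex (\<phi> x) ((t - t0) / \<delta>))
           (V \<times> {0..1}, \<lambda>(x, t). Complex (\<psi> x) t)"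
proof -
  note D = is_chartD[OF ch(1)]
  have uu: "cnj u * (u * z) = z" for z using u by auto
  have nu: "norm u = 1" using u by auto
  define \<Phi> where "\<Phi> = (\<lambda>(x, t). u * Complex (\<phi> x) ((t - t0) / \<delta>))"
  define \<Psi> where "\<Psi> = (\<lambda>(x, t). Complex (\<psi> x) t)"
  define h where "h = \<psi> \<circ> inv_into U \<phi>"
  have h: "h (\<phi> z) = \<psi> z" if "z \<in> U" for z using D(4) that by (simp add: h_def)
  have inj: "inj_on \<Phi> (U \<times> J)"
    using is_chartD(4)[OF is_chart_cylinder[OF ch(1) J \<delta> u, of t0]] by (simp add: \<Phi>_def)
  have "winding_number (\<Psi> \<circ> inv_into (U \<times> J) \<Phi> \<circ> circlepath (\<Phi> p) r) (\<Psi> p) = 1"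
    if p: "p \<in> (U \<times> J) \<inter> (V \<times> {0..1})" and r: "0 < r"
      and ball: "cball (\<Phi> p) r \<subseteq> \<Phi> ` ((U \<times> J) \<inter> (V \<times> {0..1}))" for p r
  proof -
    obtain x t where xt: "p = (x, t)" "x \<in> U" "x \<in> V" "t \<in> J" using p by auto
    define g where "g = \<Psi> \<circ> inv_into (U \<times> J) \<Phi> \<circ> circlepath (\<Phi> p) r"
    \<comment> \<open>The diameter of the disc in the direction \<open>u\<close> corresponds to this
      whole interval of curve coordinates, as \<open>transition_less\<close> requires.\<close>
    have sub: "{\<phi> x - r..\<phi> x + r} \<subseteq> \<phi> ` (U \<inter> V)"
    proof
      fix a assume a: "a \<in> {\<phi> x - r..\<phi> x + r}"
      let ?z = "\<Phi> p + u * of_real (a - \<phi> x)"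
      have "?z \<in> cball (\<Phi> p) r" using a nu
        by (auto simp: dist_norm norm_mult abs_le_iff simp del: of_real_diff)
      then obtain x' t' where x': "x' \<in> U \<inter> V" "?z = \<Phi> (x', t')" using ball by blast
      then have "cnj u * ?z = cnj u * \<Phi> (x', t')" by simp
      then have "Complex (\<phi> x) ((t - t0) / \<delta>) + of_real (a - \<phi> x) = Complex (\<phi> x') ((t' - t0) / \<delta>)"
        by (simp add: \<Phi>_def xt(1) ring_distribs(1) uu)
      then have "a = \<phi> x'" by (simp add: complex_eq_iff)
      then show "a \<in> \<phi> ` (U \<inter> V)" using x' by blast
    qed
    have mono: "\<phi> x < \<phi> y \<Longrightarrow> \<psi> x < \<psi> y" "\<phi> y < \<phi> x \<Longrightarrow> \<psi> y < \<psi> x"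
      if y: "y \<in> U \<inter> V" "\<phi> y \<in> {\<phi> x - r..\<phi> x + r}" for y
    proof -
      have "{\<phi> x..\<phi> y} \<subseteq> {\<phi> x - r..\<phi> x + r}" "{\<phi> y..\<phi> x} \<subseteq> {\<phi> x - r..\<phi> x + r}"
        using y(2) r by auto
      then have *: "{\<phi> x..\<phi> y} \<subseteq> \<phi> ` (U \<inter> V)" "{\<phi> y..\<phi> x} \<subseteq> \<phi> ` (U \<inter> V)" using sub by blast+
      show "\<phi> x < \<phi> y \<Longrightarrow> \<psi> x < \<psi> y"
        by (rule transition_less[OF ch comp _ _ *(1)]) (use y(1) xt in auto)
      show "\<phi> y < \<phi> x \<Longrightarrow> \<psi> y < \<psi> x"
        by (rule transition_less[OF ch comp _ _ *(2)]) (use y(1) xt in auto)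
    qed
    have point: "\<exists>y s'. y \<in> U \<inter> V \<and> s' \<in> J \<and> circlepath (\<Phi> p) r s = \<Phi> (y, s') \<and>
        g s = Complex (\<psi> y) s' \<and> cnj u * circlepath (\<Phi> p) r s = Complex (\<phi> y) ((s' - t0) / \<delta>)" for s
    proof -
      have "circlepath (\<Phi> p) r s \<in> cball (\<Phi> p) r"
        using r by (simp add: circlepath dist_norm norm_mult)
      then obtain y s' where y: "y \<in> U \<inter> V" "s' \<in> J" "circlepath (\<Phi> p) r s = \<Phi> (y, s')"
        using ball by blast
      then have "g s = \<Psi> (y, s')" using inv_into_f_f[OF inj, of "(y, s')"] by (simp add: g_def)
      then show ?thesis using y by (auto simp: \<Psi>_def \<Phi>_def uu)
    qed
    \<comment> \<open>Without the choice of an inverse: the loop is an explicit function of the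
      circle, from which continuity can be read off.\<close>
    have gh: "g = (\<lambda>s. Complex (h (Re (cnj u * circlepath (\<Phi> p) r s)))
                           (t0 + \<delta> * Im (cnj u * circlepath (\<Phi> p) r s)))"
    proof
      fix s
      obtain y s' where "y \<in> U \<inter> V" "g s = Complex (\<psi> y) s'"
          "cnj u * circlepath (\<Phi> p) r s = Complex (\<phi> y) ((s' - t0) / \<delta>)" using point by blast
      then show "g s = Complex (h (Re (cnj u * circlepath (\<Phi> p) r s)))
          (t0 + \<delta> * Im (cnj u * circlepath (\<Phi> p) r s))" using \<delta> h by simp
    qed
    have ch1: "continuous_on {0..1} (\<lambda>s. h (Re (cnj u * circlepath (\<Phi> p) r s)))"
    proof (rule continuous_on_compose2[OF continuous_on_transition[OF ch, folded h_def]])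
      show "continuous_on {0..1} (\<lambda>s. Re (cnj u * circlepath (\<Phi> p) r s))"
        unfolding circlepath by (intro continuous_intros)
      show "(\<lambda>s. Re (cnj u * circlepath (\<Phi> p) r s)) ` {0..1} \<subseteq> \<phi> ` (U \<inter> V)"
      proof clarify
        fix s :: real
        obtain y s' where "y \<in> U \<inter> V"
            "cnj u * circlepath (\<Phi> p) r s = Complex (\<phi> y) ((s' - t0) / \<delta>)" using point by blast
        then show "Re (cnj u * circlepath (\<Phi> p) r s) \<in> \<phi> ` (U \<inter> V)" by auto
      qed
    qed
    have ch2: "continuous_on {0..1} (\<lambda>s. t0 + \<delta> * Im (cnj u * circlepath (\<Phi> p) r s))"
      unfolding circlepath by (intro continuous_intros)
    have "path g"
      unfolding path_def gh Complex_eq by (intro continuous_intros ch1 ch2)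
    moreover have "circlepath (\<Phi> p) r 1 = circlepath (\<Phi> p) r 0" by (simp add: circlepath)
    then have "pathfinish g = pathstart g"
      by (simp add: pathfinish_def pathstart_def g_def)
    \<comment> \<open>In terms of the unit vector \<open>e\<close>, the inner product is a sum of
      two products of factors with equal signs. Both are nonnegative, and since \<open>e\<close> is
      not zero at least one of them is positive.\<close>
    moreover have "0 < Re ((g s - \<Psi> p) * cnj (cnj u * exp (2 * of_real pi * \<i> * s)))" for s
    proof -
      obtain y s' where y: "y \<in> U \<inter> V" "g s = Complex (\<psi> y) s'"
          "cnj u * circlepath (\<Phi> p) r s = Complex (\<phi> y) ((s' - t0) / \<delta>)" using point by blast
      define e where "e = cnj u * exp (2 * of_real pi * \<i> * s)"
      have "cnj u * circlepath (\<Phi> p) r s = Complex (\<phi> x) ((t - t0) / \<delta>) + of_real r * e"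
        by (simp add: circlepath \<Phi>_def xt(1) ring_distribs(1) uu e_def)
      with y(3) have "of_real r * e = Complex (\<phi> y - \<phi> x) ((s' - t) / \<delta>)"
        using \<delta> by (simp add: complex_eq_iff diff_divide_distrib)
      then have "r * Re e = \<phi> y - \<phi> x" "r * Im e = (s' - t) / \<delta>"
        by (simp_all add: complex_eq_iff)
      then have re: "Re e = (\<phi> y - \<phi> x) / r" "Im e = (s' - t) / \<delta> / r"
        using r by (metis nonzero_mult_div_cancel_left less_irrefl)+
      have ne: "norm e = 1" using nu by (simp add: norm_mult e_def)
      have "\<bar>Re e\<bar> \<le> 1" using abs_Re_le_cmod[of e] ne by simp
      then have "\<phi> y \<in> {\<phi> x - r..\<phi> x + r}"
        unfolding re(1) using r by (auto simp: abs_le_iff field_simps)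
      note m = mono[OF y(1) this]
      have "Re e \<noteq> 0 \<or> Im e \<noteq> 0" using ne by (metis complex_eqI norm_zero zero_complex.sel zero_neq_one)
      then have nz: "\<phi> y \<noteq> \<phi> x \<or> s' \<noteq> t" unfolding re by auto
      have p1': "0 < (\<psi> y - \<psi> x) * ((\<phi> y - \<phi> x) / r)" if "\<phi> y \<noteq> \<phi> x"
      proof (cases "\<phi> x < \<phi> y")
        case True
        then show ?thesis using m(1) r by simp
      next
        case False
        then have "\<phi> y < \<phi> x" using that by simp
        then show ?thesis using m(2) r by (simp add: mult_neg_neg divide_neg_pos)
      qed
      then have p1: "0 \<le> (\<psi> y - \<psi> x) * ((\<phi> y - \<phi> x) / r)"
        by (cases "\<phi> y = \<phi> x") (auto intro: less_imp_le)
      have p2: "0 \<le> (s' - t) * ((s' - t) / \<delta> / r)"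
        and p2': "s' \<noteq> t \<Longrightarrow> 0 < (s' - t) * ((s' - t) / \<delta> / r)"
        using \<delta> r by (auto simp: zero_less_mult_iff zero_less_divide_iff)
      have "Re ((g s - \<Psi> p) * cnj e) = (\<psi> y - \<psi> x) * Re e + (s' - t) * Im e"
        by (simp add: y(2) \<Psi>_def xt(1) del: complex_cnj_mult)
      then show ?thesis unfolding e_def[symmetric] re using p1 p1' p2 p2' nz by fastforce
    qed
    moreover have "cnj u \<in> {1, \<i>, -\<i>}" using u by auto
    ultimately show ?thesis
      unfolding g_def[symmetric] by (intro winding_number_eq_1_if_inner_pos[of "cnj u"]) auto
  qed
  then show ?thesis unfolding compatible2_def \<Phi>_def[symmetric] \<Psi>_def[symmetric] by auto
qed

lemma positive_chart2_cylinder: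
  assumes "compact_oriented_curve X" "positive_chart1 X (U, \<phi>)"
    and "J \<in> intervals" "openin (top_of_set {0..1}) J"
    and "0 < \<delta>" "u \<in> {1, \<i>, -\<i>}"
  shows "positive_chart2 (cylinder X) (U \<times> J, \<lambda>(x, t). u * Complex (\<phi> x) ((t - t0) / \<delta>))"
  unfolding positive_chart2_def
proof (intro conjI ballI)
  show "is_chart rects (cylinder X) (U \<times> J, \<lambda>(x, t). u * Complex (\<phi> x) ((t - t0) / \<delta>))"
    using assms by (intro is_chart_cylinder) (auto simp: positive_chart1_def)
  fix d assume "d \<in> atlas (cylinder X)"
  then obtain V \<psi> where d: "d = (V \<times> {0..1}, \<lambda>(x, t). Complex (\<psi> x) t)" "(V, \<psi>) \<in> atlas X"
    by (auto simp: cylinder_def)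
  then show "compatible2 (U \<times> J, \<lambda>(x, t). u * Complex (\<phi> x) ((t - t0) / \<delta>)) d"
    unfolding d(1) using assms
    by (intro compatible2_cylinder) (auto simp: positive_chart1_def compact_oriented_curve_def)
qed

lemma compact_oriented_surface_cylinder:
  assumes X: "compact_oriented_curve X"
  shows "compact_oriented_surface (cylinder X)"
proof -
  have I: "{0..1} \<in> intervals"
    by (auto simp: intervals_def is_interval_cc)
  have atl: "atlas (cylinder X) =
      (\<lambda>c. (fst c \<times> {0..1}, \<lambda>(x, t). Complex (snd c x) t)) ` atlas X"
    by (auto simp: cylinder_def image_iff Bex_def) blast+
  have "positive_chart2 (cylinder X) (fst c \<times> {0..1}, \<lambda>(x, t). Complex (snd c x) t)"
    if "c \<in> atlas X" for c
    using positive_chart2_cylinder[OF X _ I, of "fst c" "snd c" 1 1 0] positive_chart1_in_atlas[OF X that]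
    by simp
  then have "\<forall>c \<in> atlas (cylinder X). positive_chart2 (cylinder X) c"
    unfolding atl by blast
  moreover have "compact_space (space_of (cylinder X))" "Hausdorff_space (space_of (cylinder X))"
    using X by (auto simp: cylinder_def compact_oriented_curve_def compact_space_prod_topology
        Hausdorff_space_prod_topology compact_space_subtopology Hausdorff_space_subtopology)
  moreover have "(\<Union>c \<in> atlas (cylinder X). fst c) = (\<Union>c \<in> atlas X. fst c) \<times> {0..1}"
    unfolding atl by auto
  then have "(\<Union>c \<in> atlas (cylinder X). fst c) = pts X \<times> {0..1}"
    using X by (simp add: compact_oriented_curve_def)
  ultimately show ?thesis
    unfolding compact_oriented_surface_def pts_cylinder by blast
qed

section \<open>Erecting stubs\<close>

lemma intervals_between:
  assumes "a < b" "{a<..<b} \<subseteq> I" "I \<subseteq> {a..b}"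
  shows "I \<in> intervals"
proof -
  have "z \<in> I" if "x \<in> I" "y \<in> I" "x \<le> z" "z \<le> y" for x y z :: real
  proof (cases "z = x \<or> z = y")
    case False
    have "x \<in> {a..b}" "y \<in> {a..b}" using that assms(3) by auto
    then have "z \<in> {a<..<b}" using False that by auto
    then show ?thesis using assms(2) by blast
  qed (use that in auto)
  then have "is_interval I" unfolding is_interval_1 by blast
  moreover have "{a<..<b} \<subseteq> interior I" using assms(2) by (simp add: interior_maximal)
  moreover have "{a<..<b} \<noteq> {}" using assms(1) by simp
  ultimately show ?thesis unfolding intervals_def by blast
qed

lemma affine_window_image:
  fixes \<delta> :: real
  assumes "0 < \<delta>"
  shows "(\<lambda>t. (t - t0) / \<delta>) ` S = {y. t0 + \<delta> * y \<in> S}"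
proof (intro set_eqI iffI)
  fix y assume "y \<in> {y. t0 + \<delta> * y \<in> S}"
  then show "y \<in> (\<lambda>t. (t - t0) / \<delta>) ` S"
    using assms by (intro image_eqI[of _ _ "t0 + \<delta> * y"]) auto
qed (use assms in auto)

lemma affine_window_image_ball:
  fixes \<delta> :: real
  assumes \<delta>: "0 < \<delta>"
  shows "(\<lambda>t. (t - t0) / \<delta>) ` {t0 - \<delta><..<t0 + \<delta>} = {-1<..<1}"
proof -
  have iff: "t0 - \<delta> < t0 + \<delta> * y \<longleftrightarrow> -1 < y" "t0 + \<delta> * y < t0 + \<delta> \<longleftrightarrow> y < 1" for y
    using \<delta> mult_less_cancel_left_pos[of \<delta> "-1" y] mult_less_cancel_left_pos[of \<delta> y 1] by auto
  show ?thesis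
    unfolding affine_window_image[OF \<delta>] greaterThanLessThan_iff iff
    by (simp only: greaterThanLessThan_def greaterThan_def lessThan_def Collect_conj_eq)
qed

text \<open>
  A window around height \<open>t0\<close> of the cylinder, rescaled by \<open>t \<mapsto> (t - t0) / \<delta>\<close> so that it and its part
  below height \<open>1/2\<close> have the shapes demanded by the local model at a point of a stub.
\<close>

lemma stub_window:
  fixes t0 :: real
  assumes t0: "t0 \<in> {0..1/2}"
  obtains \<delta> J where "0 < \<delta>" "J \<in> intervals" "openin (top_of_set {0..1}) J" "t0 \<in> J"
    "J \<inter> {0..1/2} \<in> intervals"
    "(\<lambda>t. (t - t0) / \<delta>) ` (J \<inter> {0..1/2}) \<in> {{-1<..<1}, {0..<1}, {-1<..0}}"
    "(\<lambda>t. (t - t0) / \<delta>) ` J \<in> {{-1<..<1}, (\<lambda>t. (t - t0) / \<delta>) ` (J \<inter> {0..1/2})}"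
proof -
  consider "t0 = 0" | "0 < t0" "t0 < 1/2" | "t0 = 1/2" using t0 by force
  then show ?thesis
  proof cases
    case 1
    \<comment> \<open>At the foot of a stub the window and the stub start together on the boundary:
      both rescale to \<open>{0..<1}\<close>, giving a half-square.\<close>
    show ?thesis
    proof (rule that[of "1/2" "{0..<1/2}"])
      have "{0..<1/2::real} = {0..1} \<inter> {..<1/2}" by auto
      then show "openin (top_of_set {0..1}) {0..<1/2::real}" by (metis openin_open_Int open_lessThan)
      have i: "{0..<1/2::real} \<inter> {0..1/2} = {0..<1/2}" by auto
      show "{0..<1/2::real} \<in> intervals" by (rule intervals_between[of 0 "1/2"]) auto
      then show "{0..<1/2::real} \<inter> {0..1/2} \<in> intervals" unfolding i .
      have "(\<lambda>t. (t - t0) / (1/2)) ` {0..<1/2} = {0..<1}"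
        using 1 by (subst affine_window_image) auto
      then show "(\<lambda>t. (t - t0) / (1/2)) ` ({0..<1/2} \<inter> {0..1/2}) \<in> {{-1<..<1}, {0..<1}, {-1<..0}}"
        unfolding i by blast
      show "(\<lambda>t. (t - t0) / (1/2)) ` {0..<1/2} \<in> {{-1<..<1}, (\<lambda>t. (t - t0) / (1/2)) ` ({0..<1/2} \<inter> {0..1/2})}"
        unfolding i by blast
    qed (use 1 in auto)
  next
    case 2
    \<comment> \<open>No larger than the distance to either end, so the window lies within the
      height of the stub and the strand crosses a full square.\<close>
    define \<delta> where "\<delta> = min t0 (1/2 - t0)"
    have \<delta>: "0 < \<delta>" "\<delta> \<le> t0" "\<delta> \<le> 1/2 - t0" using 2 by (auto simp: \<delta>_def)
    let ?J = "{t0 - \<delta><..<t0 + \<delta>}"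
    show ?thesis
    proof (rule that[of \<delta> ?J])
      have "?J = {0..1} \<inter> ?J" using \<delta> by auto
      then show "openin (top_of_set {0..1}) ?J" by (metis openin_open_Int open_greaterThanLessThan)
      have i: "?J \<inter> {0..1/2} = ?J" using \<delta> by auto
      show "?J \<in> intervals" by (rule intervals_between[of "t0 - \<delta>" "t0 + \<delta>"]) (use \<delta> in auto)
      then show "?J \<inter> {0..1/2} \<in> intervals" unfolding i .
      have "(\<lambda>t. (t - t0) / \<delta>) ` ?J = {-1<..<1}" using \<delta>(1) by (rule affine_window_image_ball)
      then show "(\<lambda>t. (t - t0) / \<delta>) ` (?J \<inter> {0..1/2}) \<in> {{-1<..<1}, {0..<1}, {-1<..0}}"
          "(\<lambda>t. (t - t0) / \<delta>) ` ?J \<in> {{-1<..<1}, (\<lambda>t. (t - t0) / \<delta>) ` (?J \<inter> {0..1/2})}"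
        unfolding i by blast+
    qed (use \<delta> in auto)
  next
    case 3
    \<comment> \<open>At the upper end the window reaches above the stub: the stub rescales to
      \<open>{-1<..0}\<close> while the window is all of \<open>{-1<..<1}\<close>, as at an interior
      univalent vertex.\<close>
    show ?thesis
    proof (rule that[of "1/2" "{0<..<1}"])
      have "{0<..<1::real} = {0..1} \<inter> {0<..<1}" by auto
      then show "openin (top_of_set {0..1}) {0<..<1::real}"
        by (metis openin_open_Int open_greaterThanLessThan)
      have i: "{0<..<1::real} \<inter> {0..1/2} = {0<..1/2}" by auto
      show "{0<..<1::real} \<in> intervals" by (rule intervals_between[of 0 1]) auto
      show "{0<..<1::real} \<inter> {0..1/2} \<in> intervals"
        unfolding i by (rule intervals_between[of 0 "1/2"]) auto
      have "(\<lambda>t. (t - t0) / (1/2)) ` {0<..1/2} = {-1<..0}"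
        using 3 by (subst affine_window_image) auto
      then show "(\<lambda>t. (t - t0) / (1/2)) ` ({0<..<1} \<inter> {0..1/2}) \<in> {{-1<..<1}, {0..<1}, {-1<..0}}"
        unfolding i by blast
      have "(\<lambda>t. (t - t0) / (1/2)) ` {0<..<1} = {-1<..<1}"
        using 3 by (subst affine_window_image) auto
      then show "(\<lambda>t. (t - t0) / (1/2)) ` {0<..<1} \<in> {{-1<..<1}, (\<lambda>t. (t - t0) / (1/2)) ` ({0<..<1} \<inter> {0..1/2})}"
        by blast
    qed (use 3 in auto)
  qed
qed

lemma cut_point_chart:
  assumes X: "compact_oriented_curve X" and C: "is_cut_diagram1 X C" and p: "p \<in> dom C"
  obtains N \<alpha> where "positive_chart1 X (N, \<alpha>)" "\<alpha> ` N = {-1<..<1}" "N \<inter> dom C = {p}" "\<alpha> p = 0"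
proof -
  have fin: "finite (dom C)" and pX: "p \<in> pts X" "p \<notin> bdry X"
    using C p by (auto simp: is_cut_diagram1_def)
  obtain U \<phi> where U: "(U, \<phi>) \<in> atlas X" "p \<in> U"
    using X pX(1) unfolding compact_oriented_curve_def by fastforce
  have pc: "positive_chart1 X (U, \<phi>)" using positive_chart1_in_atlas[OF X U(1)] .
  then have inj: "inj_on \<phi> U" using is_chartD(4) by (auto simp: positive_chart1_def)
  have "\<phi> p \<in> interior (\<phi> ` U)" using pX(2) U unfolding bdry_def by blast
  then obtain e1 where e1: "e1 > 0" "ball (\<phi> p) e1 \<subseteq> \<phi> ` U" by (auto simp: mem_interior)
  obtain e2 where e2: "e2 > 0" "\<And>y. y \<in> \<phi> ` (dom C \<inter> U) \<Longrightarrow> y \<noteq> \<phi> p \<Longrightarrow> e2 \<le> dist (\<phi> p) y"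
    using finite_set_avoid[of "\<phi> ` (dom C \<inter> U)" "\<phi> p"] fin by auto
  \<comment> \<open>\<open>e1\<close> keeps the interval inside the chart, which is possible because
    \<open>p\<close> is not a boundary point; \<open>e2\<close> keeps the finitely many other
    cut-points out.\<close>
  define e where "e = min e1 e2"
  have e: "e > 0" "e \<le> e1" "e \<le> e2" using e1 e2 by (auto simp: e_def)
  define J where "J = {\<phi> p - e<..<\<phi> p + e}"
  have JU: "J \<subseteq> \<phi> ` U" using e1(2) e unfolding J_def ball_eq_greaterThanLessThan by auto
  have "J \<in> intervals" unfolding J_def by (rule intervals_between[of "\<phi> p - e" "\<phi> p + e"]) (use e in auto)
  moreover have "openin (top_of_set (\<phi> ` U)) J"
    using JU by (simp add: J_def open_subset)
  ultimately have "positive_chart1 X ({x \<in> U. \<phi> x \<in> J}, \<lambda>x. (1 / e) * \<phi> x + (- \<phi> p / e))"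
    using pc e(1) by (intro positive_chart1_restrict_affine) auto
  moreover have "(\<lambda>x. (1 / e) * \<phi> x + (- \<phi> p / e)) ` {x \<in> U. \<phi> x \<in> J} = {-1<..<1}"
  proof -
    have J: "\<phi> ` {x \<in> U. \<phi> x \<in> J} = J" using JU by blast
    have "(\<lambda>x. (1 / e) * \<phi> x + (- \<phi> p / e)) ` {x \<in> U. \<phi> x \<in> J} = (\<lambda>t. (t - \<phi> p) / e) ` J"
      by (subst (2) J[symmetric]) (simp add: image_image diff_divide_distrib)
    then show ?thesis unfolding J_def affine_window_image_ball[OF e(1)] .
  qed
  moreover have "{x \<in> U. \<phi> x \<in> J} \<inter> dom C = {p}"
  proof -
    have "q = p" if "q \<in> U" "\<phi> q \<in> J" "q \<in> dom C" for q
    proof (rule ccontr)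
      assume "q \<noteq> p"
      then have "\<phi> q \<noteq> \<phi> p" using inj U(2) that(1) by (auto dest: inj_onD)
      then have "e2 \<le> dist (\<phi> p) (\<phi> q)" using e2(2) that by blast
      then show False using that(2) e by (auto simp: J_def dist_real_def)
    qed
    then show ?thesis using p U(2) e by (auto simp: J_def)
  qed
  ultimately show ?thesis using that by force
qed

section \<open>The abstract curve formed by the stubs\<close>

locale stubs =
  fixes X :: "('a, real) charted" and C :: "'a cut_diagram1" and pos :: "'a \<Rightarrow> real"
  assumes curve: "compact_oriented_curve X" and connected: "connected_space (space_of X)"
    and nonempty: "pts X \<noteq> {}" and diagram: "is_cut_diagram1 X C" and inj: "inj_on pos (dom C)"
begin

text \<open>The abstract curve has to be carried by complex numbers. The injection
  \<open>pos\<close> supplies distinct abscissae and so keeps the stubs disjoint; the imaginary part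
  is the height in the cylinder.\<close>

definition stub :: "'a \<Rightarrow> complex set" where
  "stub p = Complex (pos p) ` {0..1/2}"

text \<open>Upwards for a positive cut-point, which then is an inward-oriented endpoint at the
  bottom. Outside \<open>dom C\<close> the value is arbitrary but still 1 or -1.\<close>

definition dir :: "'a \<Rightarrow> real" where
  "dir p = (if fst (the (C p)) = Pos then 1 else -1)"

definition stub_curve :: "(complex, real) charted" where
  "stub_curve = \<lparr>space_of = top_of_set (\<Union>p \<in> dom C. stub p),
     atlas = (\<lambda>p. (stub p, \<lambda>z. dir p * Im z)) ` dom C\<rparr>"

definition region :: "('a \<times> real) set" where
  "region = pts X \<times> {0..1} - dom C \<times> {0..1/2}"

definition stub_diagram :: "(complex, 'a \<times> real) cut_diagram2" where
  "stub_diagram = \<lparr>strands = stub_curve, imm = \<lambda>z. (inv_into (dom C) pos (Re z), Im z),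
     unders = {}, label = \<lambda>_. region\<rparr>"

lemma dir: "dir p = 1 \<or> dir p = -1" "dir p * dir p = 1"
  by (auto simp: dir_def)

lemma finite_dom: "finite (dom C)" and dom_subset: "dom C \<subseteq> pts X"
  using diagram by (auto simp: is_cut_diagram1_def)

lemma stub_disjoint: "p \<in> dom C \<Longrightarrow> q \<in> dom C \<Longrightarrow> z \<in> stub p \<Longrightarrow> z \<in> stub q \<Longrightarrow> p = q"
  using inj by (auto simp: stub_def dest: inj_onD)

lemma compact_stub: "compact (stub p)"
  unfolding stub_def
  by (intro compact_continuous_image) (auto simp: Complex_eq intro!: continuous_intros)

text \<open>The other stubs are finitely many compact sets, so their union is closed.\<close>

lemma openin_stub:
  assumes "p \<in> dom C"
  shows "openin (top_of_set (\<Union>p \<in> dom C. stub p)) (stub p)"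
proof -
  have "closed (\<Union>q \<in> dom C - {p}. stub q)"
    using finite_dom compact_stub by (auto intro!: compact_imp_closed)
  moreover have "stub p = (\<Union>p \<in> dom C. stub p) \<inter> - (\<Union>q \<in> dom C - {p}. stub q)"
    using assms stub_disjoint by blast
  ultimately show ?thesis by (metis openin_open_Int open_Compl)
qed

lemma pts_stub_curve [simp]: "pts stub_curve = (\<Union>p \<in> dom C. stub p)"
  by (simp add: stub_curve_def)

text \<open>\<open>dir p\<close> is its own inverse, so one more multiplication by it recovers the
  height. Taking \<open>K = {0..1/2}\<close>, \<open>\<delta> = 1\<close> and \<open>t0 = 0\<close>
  gives the atlas charts; smaller \<open>K\<close> gives the part of a stub seen in a
  window.\<close>

lemma positive_chart1_stub:
  assumes p: "p \<in> dom C" and K: "K \<in> intervals" "openin (top_of_set {0..1/2}) K" and \<delta>: "0 < \<delta>"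
  shows "positive_chart1 stub_curve (Complex (pos p) ` K, \<lambda>z. dir p * ((Im z - t0) / \<delta>))"
    (is "positive_chart1 _ (?U, ?f)")
  unfolding positive_chart1_def
proof (intro conjI ballI)
  obtain T where T: "open T" "K = {0..1/2} \<inter> T" using K(2) by (auto simp: openin_open)
  have "?U = stub p \<inter> Im -` T" unfolding stub_def T(2) by auto
  moreover have "open (Im -` T)" by (intro open_vimage T continuous_intros)
  ultimately have U: "openin (space_of stub_curve) ?U"
    using openin_stub[OF p] by (simp add: stub_curve_def openin_Int_open)
  show "is_chart intervals stub_curve (?U, ?f)"
  proof (rule is_chartI[OF U, where g = "\<lambda>y. Complex (pos p) (t0 + \<delta> * (dir p * y))"])
    have "?f ` ?U = (\<lambda>t. (dir p / \<delta>) * t + (- dir p * t0 / \<delta>)) ` K"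
      unfolding image_image by (intro image_cong) (auto simp: diff_divide_distrib right_diff_distrib)
    moreover have "dir p / \<delta> \<noteq> 0" using dir(1)[of p] \<delta> by auto
    ultimately show "?f ` ?U \<in> intervals" using affine_image_intervals[OF K(1)] by metis
    show "continuous_map (subtopology (space_of stub_curve) ?U) euclidean ?f"
      using \<delta> by (auto simp: stub_curve_def subtopology_subtopology intro!: continuous_intros)
    have inv: "Complex (pos p) (t0 + \<delta> * (dir p * ?f x)) = x" if "x \<in> ?U" for x
    proof -
      have "dir p * ?f x = (Im x - t0) / \<delta>" using dir(2)[of p] by (metis mult.assoc mult_1)
      then show ?thesis using that \<delta> by (auto simp only: image_iff complex.sel) simp
    qed
    then show "\<And>x. x \<in> ?U \<Longrightarrow> Complex (pos p) (t0 + \<delta> * (dir p * ?f x)) = x" .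
    have US: "?U \<subseteq> (\<Union>p \<in> dom C. stub p)" using p T(2) unfolding stub_def by blast
    have "(\<lambda>y. Complex (pos p) (t0 + \<delta> * (dir p * y))) ` (?f ` ?U) \<subseteq> (\<Union>p \<in> dom C. stub p)"
    proof (intro image_subsetI, erule imageE[of _ ?f], hypsubst)
      fix x assume "x \<in> ?U"
      then show "Complex (pos p) (t0 + \<delta> * (dir p * ?f x)) \<in> (\<Union>p \<in> dom C. stub p)"
        unfolding inv[OF \<open>x \<in> ?U\<close>] using US by blast
    qed
    moreover have "continuous_on (?f ` ?U) (\<lambda>y. Complex (pos p) (t0 + \<delta> * (dir p * y)))"
      unfolding Complex_eq by (intro continuous_intros)
    ultimately show "continuous_map (top_of_set (?f ` ?U)) (space_of stub_curve)
        (\<lambda>y. Complex (pos p) (t0 + \<delta> * (dir p * y)))"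
      unfolding stub_curve_def charted.simps continuous_map_in_subtopology
        continuous_map_iff_continuous image_subset_iff_funcset[symmetric] topspace_euclidean_subtopology
      by blast
  qed
  fix d assume "d \<in> atlas stub_curve"
  then obtain q where q: "q \<in> dom C" "d = (stub q, \<lambda>z. dir q * Im z)"
    by (auto simp: stub_curve_def)
  have Up: "?U \<subseteq> stub p" using T(2) unfolding stub_def by blast
  show "compatible1 stub_curve (?U, ?f) d"
    unfolding compatible1_def q(2) prod.case
  proof
    fix x assume "x \<in> ?U \<inter> stub q"
    then have "x \<in> ?U" "q = p" using stub_disjoint[OF p q(1)] Up by blast+
    moreover have "?f y < ?f z \<longleftrightarrow> dir p * Im y < dir p * Im z" for y z
      using dir(1)[of p] \<delta> by (auto simp: divide_less_cancel)
    ultimately show "\<exists>W. openin (space_of stub_curve) W \<and> x \<in> W \<and> W \<subseteq> ?U \<inter> stub q \<and>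
        (\<forall>y\<in>W. \<forall>z\<in>W. (?f y < ?f z) = (dir q * Im y < dir q * Im z))"
      using U Up by (intro exI[of _ ?U]) auto
  qed
qed

lemma compact_oriented_stub_curve: "compact_oriented_curve stub_curve"
proof -
  have "positive_chart1 stub_curve (stub p, \<lambda>z. dir p * Im z)" if "p \<in> dom C" for p
    using positive_chart1_stub[OF that, of "{0..1/2}" 1 0]
    by (simp add: stub_def intervals_between[of 0 "1/2"] subset_iff)
  moreover have "compact (\<Union>p \<in> dom C. stub p)" using finite_dom compact_stub by blast
  ultimately show ?thesis
    unfolding compact_oriented_curve_def
    by (auto simp: stub_curve_def compact_space_subtopology Hausdorff_space_subtopology)
qed

section \<open>The immersed stubs: local models, the single region, labels\<close>

lemma imm_stub: "p \<in> dom C \<Longrightarrow> imm stub_diagram (Complex (pos p) t) = (p, t)"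
  using inj by (simp add: stub_diagram_def)

lemma diagram_set_stub_diagram: "diagram_set stub_diagram = dom C \<times> {0..1/2}"
proof -
  have "pts (strands stub_diagram) = (\<Union>p \<in> dom C. stub p)" by (simp add: stub_diagram_def)
  moreover have "imm stub_diagram ` stub p = {p} \<times> {0..1/2}" if "p \<in> dom C" for p
    unfolding stub_def image_image imm_stub[OF that] by auto
  ultimately have "diagram_set stub_diagram = (\<Union>p \<in> dom C. {p} \<times> {0..1/2})"
    unfolding diagram_set_def by (simp add: image_UN)
  then show ?thesis by auto
qed

lemma preim_stub_diagram:
  assumes "N \<inter> dom C = {p}"
  shows "preim stub_diagram (N \<times> J) = Complex (pos p) ` (J \<inter> {0..1/2})"
proof (rule set_eqI)
  fix w
  have "pts (strands stub_diagram) = (\<Union>p \<in> dom C. stub p)" by (simp add: stub_diagram_def)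
  then have "w \<in> preim stub_diagram (N \<times> J) \<longleftrightarrow>
      (\<exists>q \<in> dom C. \<exists>t \<in> {0..1/2}. w = Complex (pos q) t) \<and> imm stub_diagram w \<in> N \<times> J"
    by (simp add: preim_def stub_def image_iff)
  also have "\<dots> \<longleftrightarrow> (\<exists>q \<in> dom C. \<exists>t \<in> {0..1/2}. w = Complex (pos q) t \<and> q \<in> N \<and> t \<in> J)"
    using imm_stub by (metis mem_Sigma_iff)
  also have "\<dots> \<longleftrightarrow> (\<exists>q \<in> N \<inter> dom C. \<exists>t \<in> J \<inter> {0..1/2}. w = Complex (pos q) t)"
    by blast
  also have "\<dots> \<longleftrightarrow> w \<in> Complex (pos p) ` (J \<inter> {0..1/2})"
    unfolding assms by blast
  finally show "w \<in> preim stub_diagram (N \<times> J) \<longleftrightarrow> w \<in> Complex (pos p) ` (J \<inter> {0..1/2})" .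
qed

text \<open>The chart is the product of a chart of the curve that isolates \<open>p\<close> and
  vanishes there with a height window around \<open>t0\<close>. Hence it sees a single stub, and on
  that stub one of its coordinates is 0.\<close>

lemma arc_chart_stub_diagram:
  assumes "w \<in> pts stub_curve"
  shows "\<exists>c. arc_chart (cylinder X) stub_diagram w c"
proof -
  obtain p t0 where p: "p \<in> dom C" and t0: "t0 \<in> {0..1/2}" and w: "w = Complex (pos p) t0"
    using assms unfolding pts_stub_curve stub_def by blast
  obtain N \<alpha> where N: "positive_chart1 X (N, \<alpha>)" "\<alpha> ` N = {-1<..<1}" "N \<inter> dom C = {p}" "\<alpha> p = 0"
    using cut_point_chart[OF curve diagram p] .
  obtain \<delta> J where \<delta>: "0 < \<delta>" and J: "J \<in> intervals" "openin (top_of_set {0..1}) J" "t0 \<in> J"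
    "J \<inter> {0..1/2} \<in> intervals"
    and I: "(\<lambda>t. (t - t0) / \<delta>) ` (J \<inter> {0..1/2}) \<in> {{-1<..<1}, {0..<1}, {-1<..0}}"
    and B: "(\<lambda>t. (t - t0) / \<delta>) ` J \<in> {{-1<..<1}, (\<lambda>t. (t - t0) / \<delta>) ` (J \<inter> {0..1/2})}"
    using stub_window[OF t0] .
  \<comment> \<open>Multiplication by \<open>-\<i>\<close> or \<open>\<i>\<close> turns the vertical stub into the horizontal arc of the local model.\<close>
  define u where "u = Complex 0 (- dir p)"
  have u: "u \<in> {1, \<i>, -\<i>}" using dir(1)[of p] by (auto simp: u_def complex_eq_iff)
  define \<Phi> where "\<Phi> = (\<lambda>(x, t). u * Complex (\<alpha> x) ((t - t0) / \<delta>))"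
  have \<Phi>: "Re (\<Phi> y) = dir p * ((snd y - t0) / \<delta>)" "Im (\<Phi> y) = - dir p * \<alpha> (fst y)" for y
    by (simp_all add: \<Phi>_def u_def case_prod_unfold)
  have Re: "(\<lambda>w. Re (\<Phi> (imm stub_diagram w))) = (\<lambda>w. dir p * ((Im w - t0) / \<delta>))"
    by (simp add: \<Phi> stub_diagram_def)
  let ?U = "N \<times> J" and ?K = "J \<inter> {0..1/2}"
  have pre: "preim stub_diagram ?U = Complex (pos p) ` ?K" by (rule preim_stub_diagram[OF N(3)])
  have uminus: "uminus ` {-1<..<1::real} = {-1<..<1}" "uminus ` {0..<1::real} = {-1<..0}"
      "uminus ` {-1<..0::real} = {0..<1}" by auto
  \<comment> \<open>A downward stub reflects the strand interval, exchanging \<open>{0..<1}\<close>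
    and \<open>{-1<..0}\<close>; the three admissible intervals as a set, and the full interval by
    itself, are invariant under this.\<close>
  define L where "L = (*) (dir p) ` (\<lambda>t. (t - t0) / \<delta>) ` ?K"
  have "(*) (dir p) = id \<or> (*) (dir p) = uminus" using dir(1)[of p] by (auto simp: fun_eq_iff)
  then have sym: "(*) (dir p) ` {-1<..<1} = {-1<..<1}" and L: "L \<in> {{-1<..<1}, {0..<1}, {-1<..0}}"
    using I uminus unfolding L_def by (metis image_id id_apply, auto)
  have im: "(\<lambda>w. Re (\<Phi> (imm stub_diagram w))) ` preim stub_diagram ?U = L"
    unfolding Re pre L_def image_image by simp
  have "\<Phi> ` ?U = rect ((*) (dir p) ` (\<lambda>t. (t - t0) / \<delta>) ` J) {-1<..<1}"
  proof -
    have "\<Phi> ` ?U = (\<lambda>(a, b). Complex b (dir p * - a)) `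
        (\<alpha> ` N \<times> (*) (dir p) ` (\<lambda>t. (t - t0) / \<delta>) ` J)"
      by (force simp: image_iff complex_eq_iff \<Phi>)
    also have "\<dots> = rect ((*) (dir p) ` (\<lambda>t. (t - t0) / \<delta>) ` J) {-1<..<1}"
    proof -
      have iff: "z \<in> {-1<..<1} \<longleftrightarrow> (\<exists>a \<in> {-1<..<1}. z = dir p * - a)" for z
        using dir(1)[of p] by (auto intro: bexI[of _ z] bexI[of _ "- z"])
      have "rect S {-1<..<1} = {z. Re z \<in> S \<and> (\<exists>a \<in> {-1<..<1}. Im z = dir p * - a)}" for S
      proof (rule set_eqI)
        fix z
        show "z \<in> rect S {-1<..<1} \<longleftrightarrow> z \<in> {z. Re z \<in> S \<and> (\<exists>a \<in> {-1<..<1}. Im z = dir p * - a)}"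
          using iff[of "Im z"] unfolding rect_def mem_Collect_eq by argo
      qed
      moreover have "(\<lambda>(a, b). Complex b (dir p * - a)) ` (A \<times> S)
          = {z. Re z \<in> S \<and> (\<exists>a \<in> A. Im z = dir p * - a)}" for A S
        unfolding set_eq_iff image_iff mem_Collect_eq Bex_def split_paired_Ex mem_Times_iff
          fst_conv snd_conv prod.case complex_eq_iff complex.sel by blast
      ultimately show ?thesis unfolding N(2) by (simp only:)
    qed
    finally show ?thesis .
  qed
  then have "\<Phi> ` ?U = rect {-1<..<1} {-1<..<1} \<or> \<Phi> ` ?U = rect L {-1<..<1}"
    using B sym unfolding L_def by (metis empty_iff insert_iff)
  moreover have "positive_chart2 (cylinder X) (?U, \<Phi>)"
    unfolding \<Phi>_def using curve N(1) J(1,2) \<delta> u by (rule positive_chart2_cylinder)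
  moreover have "w \<in> preim stub_diagram ?U" unfolding pre w using J(3) t0 by blast
  moreover have "\<Phi> (imm stub_diagram w) = 0"
    unfolding w imm_stub[OF p] by (simp add: \<Phi> complex_eq_iff N(4))
  moreover have "\<forall>w \<in> preim stub_diagram ?U. Im (\<Phi> (imm stub_diagram w)) = 0"
    unfolding pre using p by (auto simp: imm_stub \<Phi> N(4))
  moreover have "positive_chart1 (strands stub_diagram)
      (preim stub_diagram ?U, \<lambda>w. Re (\<Phi> (imm stub_diagram w)))"
  proof -
    obtain T where "open T" "J = {0..1} \<inter> T" using J(2) by (auto simp: openin_open)
    then have "?K = {0..1/2} \<inter> T" by auto
    then have "openin (top_of_set {0..1/2}) ?K" using \<open>open T\<close> by (metis openin_open_Int)
    from positive_chart1_stub[OF p J(4) this \<delta>, of t0] show ?thesis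
      unfolding Re pre by (simp add: stub_diagram_def)
  qed
  ultimately have "arc_chart (cylinder X) stub_diagram w (?U, \<Phi>)"
    unfolding arc_chart_def prod.case using im L by blast
  then show ?thesis by blast
qed

text \<open>The slab above height 1/2 meets no stub and is connected because the curve is. Every
  remaining point of \<open>region\<close> lies over a point that is not a cut-point, and the full
  vertical segment there leads up to the slab.\<close>

lemma regions2_stub_diagram: "regions2 (cylinder X) stub_diagram = {region}"
proof -
  let ?T = "pts X \<times> {1/2<..1::real}"
  define \<U> where "\<U> = insert ?T ((\<lambda>x. ?T \<union> {x} \<times> {0..1}) ` (pts X - dom C))"
  have T: "connectedin (space_of (cylinder X)) ?T"
    using connected by (simp add: cylinder_def connectedin_Times connectedin_topspace connectedin_subtopology
        subset_iff)
  have "connectedin (space_of (cylinder X)) (\<Union>\<U>)"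
  proof (rule connectedin_Union)
    fix S assume "S \<in> \<U>"
    then consider "S = ?T" | x where "x \<in> pts X" "S = ?T \<union> {x} \<times> {0..1}" unfolding \<U>_def by blast
    then show "connectedin (space_of (cylinder X)) S"
    proof cases
      case 2
      have "connectedin (space_of (cylinder X)) ({x} \<times> {0..1})"
        using 2(1) by (simp add: cylinder_def connectedin_Times connectedin_subtopology)
      moreover have "(x, 1) \<in> ?T \<inter> {x} \<times> {0..1}" using 2(1) by auto
      ultimately show ?thesis unfolding 2(2) using T by (intro connectedin_Un) blast+
    qed (use T in simp)
  next
    obtain x where "x \<in> pts X" using nonempty by blast
    then have "(x, 1) \<in> \<Inter>\<U>" by (auto simp: \<U>_def)
    then show "\<Inter>\<U> \<noteq> {}" by blast
  qed
  moreover have "\<Union>\<U> = region"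
    unfolding \<U>_def region_def by (auto simp: not_le)
  ultimately have c: "connected_space (subtopology (space_of (cylinder X)) region)"
    by (simp add: connectedin_def)
  have t: "topspace (subtopology (space_of (cylinder X)) region) = region"
    unfolding topspace_subtopology pts_cylinder by (auto simp: region_def)
  obtain x where "x \<in> pts X" using nonempty by blast
  then have "(x, 1) \<in> region" by (auto simp: region_def)
  with t have "subtopology (space_of (cylinder X)) region \<noteq> trivial_topology" by force
  then have "connected_components_of (subtopology (space_of (cylinder X)) region) = {region}"
    unfolding connected_components_of_eq_singleton using c t by blast
  then show ?thesis
    unfolding regions2_def diagram_set_stub_diagram pts_cylinder region_def .
qed

text \<open>A crossing chart must contain an under-passage, so none exists and the crossing
  condition is vacuous; the endpoint condition holds because the only region is also the only
  label.\<close>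

lemma is_cut_diagram2_stub_diagram: "is_cut_diagram2 (cylinder X) stub_diagram"
proof -
  have "is_diagram (cylinder X) stub_diagram"
    unfolding is_diagram_def
    using compact_oriented_surface_cylinder[OF curve] compact_oriented_stub_curve
      arc_chart_stub_diagram by (auto simp: stub_diagram_def)
  moreover have "\<not> crossing_chart (cylinder X) stub_diagram p q V W (U, \<phi>)" for p q V W U \<phi>
    by (simp add: crossing_chart_def stub_diagram_def)
  then have "crossing_condition (cylinder X) stub_diagram"
    unfolding crossing_condition_def by blast
  moreover have "label stub_diagram c = region" for c by (simp add: stub_diagram_def)
  ultimately show ?thesis
    unfolding is_cut_diagram2_def endpoint_condition_def regions2_stub_diagram by simp
qed

section \<open>The two ends of the cylinder\<close>

lemma homeomorphic_map_cylinder_slice: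
  assumes "e \<in> {0..1}"
  shows "homeomorphic_map (space_of X) (subtopology (space_of (cylinder X)) (pts X \<times> {e})) (\<lambda>x. (x, e))"
proof -
  have "homeomorphic_maps (space_of X) (subtopology (space_of (cylinder X)) (pts X \<times> {e})) (\<lambda>x. (x, e)) fst"
    using assms unfolding homeomorphic_maps_def cylinder_def
    by (auto simp: continuous_map_in_subtopology continuous_map_pairwise o_def
        continuous_map_from_subtopology continuous_map_fst)
  then show ?thesis by (auto simp: homeomorphic_map_maps)
qed

lemma positive_chart1_slice:
  assumes "(U, \<phi>) \<in> atlas X"
  shows "positive_chart1 X ({x \<in> pts X. x \<in> U}, \<phi>)"
proof -
  have *: "positive_chart1 X (U, \<phi>)" using positive_chart1_in_atlas[OF curve assms] .
  then have "U \<subseteq> pts X" unfolding positive_chart1_def by (blast dest: is_chartD(2))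
  then have "{x \<in> pts X. x \<in> U} = U" by auto
  then show ?thesis using * by simp
qed

lemma concordance_end_0: "concordance_end X stub_diagram 0 Pos C (\<lambda>x. (x, 0))"
proof -
  have "(w \<in> initial_pts (strands stub_diagram) \<longleftrightarrow> t = Pos) \<and>
      (\<forall>c \<in> cut_arcs stub_diagram. w \<in> c \<longrightarrow> (\<lambda>x. (x, 0)) ` r \<subseteq> label stub_diagram c)"
    if w: "w \<in> pts (strands stub_diagram)" and C: "C x = Some (t, r)"
      and wx: "imm stub_diagram w = (x, 0)" for x t r w
  proof -
    obtain p s where p: "p \<in> dom C" "s \<in> {0..1/2}" "w = Complex (pos p) s"
      using w unfolding stub_diagram_def cut_diagram2.simps pts_stub_curve stub_def by blast
    then have px: "p = x" "s = 0" using wx imm_stub by auto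
    have x: "x \<in> dom C" "w \<in> stub x" using p px by (auto simp: stub_def)
    have "w \<in> initial_pts (strands stub_diagram) \<longleftrightarrow>
        (\<exists>q \<in> dom C. w \<in> stub q \<and> (\<forall>y \<in> stub q. dir q * Im w \<le> dir q * Im y))"
      by (simp add: initial_pts_def stub_diagram_def stub_curve_def)
    also have "\<dots> \<longleftrightarrow> (\<forall>y \<in> stub x. dir x * Im w \<le> dir x * Im y)"
      using x stub_disjoint by metis
    also have "\<dots> \<longleftrightarrow> (\<forall>s \<in> {0..1/2}. 0 \<le> dir x * s)"
      by (simp add: stub_def p(3) px(2))
    \<comment> \<open>For \<open>dir x = -1\<close> the upper end \<open>s = 1/2\<close> violates
      the inequality.\<close>
    also have "\<dots> \<longleftrightarrow> dir x = 1" using dir(1)[of x] by (auto dest: bspec[of _ _ "1/2"])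
    also have "\<dots> \<longleftrightarrow> t = Pos" using C by (simp add: dir_def)
    finally have "w \<in> initial_pts (strands stub_diagram) \<longleftrightarrow> t = Pos" .
    \<comment> \<open>Whatever region \<open>r\<close> is prescribed, it avoids the cut-points, so
      its copy at the bottom avoids the stubs and falls into \<open>region\<close>.\<close>
    moreover have "r \<in> regions1 X C" using diagram C by (auto simp: is_cut_diagram1_def)
    then have "r \<subseteq> pts X - dom C"
      unfolding regions1_def using connected_components_of_subset by fastforce
    then have "(\<lambda>x. (x, 0)) ` r \<subseteq> region" by (auto simp: region_def)
    ultimately show ?thesis by (simp add: stub_diagram_def)
  qed
  moreover have "(\<lambda>x. (x, 0)) ` dom C = diagram_set stub_diagram \<inter> (pts X \<times> {0})"
    unfolding diagram_set_stub_diagram using dom_subset by auto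
  moreover have "\<forall>(U, \<phi>) \<in> atlas X. positive_chart1 X ({x \<in> pts X. x \<in> U}, \<phi>)"
    using positive_chart1_slice by blast
  moreover have "(\<lambda>x. (x, 0::real)) ` K = K \<times> {0}" for K :: "'a set" by auto
  moreover have "homeomorphic_map (space_of X) (subtopology (space_of (cylinder X)) (pts X \<times> {0})) (\<lambda>x. (x, 0))"
    by (rule homeomorphic_map_cylinder_slice) simp
  ultimately show ?thesis
    unfolding concordance_end_def fst_conv by (intro conjI; blast)
qed

text \<open>The stubs stop below height 1, so the conditions on signs and labels are vacuous
  here.\<close>

lemma concordance_end_1: "concordance_end X stub_diagram 1 Neg Map.empty (\<lambda>x. (x, 1))"
  unfolding concordance_end_def fst_conv diagram_set_stub_diagram
  using homeomorphic_map_cylinder_slice[of 1] positive_chart1_slice by auto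

lemma cut_concordant_empty: "cut_concordant X C Map.empty"
proof -
  have "is_cut_diagram1 X Map.empty" by (simp add: is_cut_diagram1_def)
  moreover have "diagram_set stub_diagram \<inter> (bdry X \<times> {0..1}) = {}"
    using diagram unfolding diagram_set_stub_diagram is_cut_diagram1_def by blast
  ultimately show ?thesis
    unfolding cut_concordant_def
    using diagram is_cut_diagram2_stub_diagram concordance_end_0 concordance_end_1 by blast
qed

end

theorem lemma3p5:
  fixes X :: "('a, real) charted" and C :: "'a cut_diagram1"
  assumes "compact_oriented_curve X"
    and "space_of X homeomorphic_space top_of_set (sphere (0::complex) 1) \<or>
         space_of X homeomorphic_space top_of_set {0..1::real}"
    and "is_cut_diagram1 X C"
  shows "cut_concordant X C Map.empty"
proof -
  have "connected_space (top_of_set (sphere (0::complex) 1))" "connected_space (top_of_set {0..1::real})"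
    using connected_sphere[of "0::complex" 1] connected_Icc[of "0::real" 1]
    by (simp_all flip: connectedin_iff_connected add: connectedin_def)
  then have "connected_space (space_of X)"
    using assms(2) by (metis homeomorphic_connected_space)
  moreover have "pts X \<noteq> {}"
  proof
    assume "pts X = {}"
    then have "top_of_set (sphere (0::complex) 1) = trivial_topology \<or>
        top_of_set {0..1::real} = trivial_topology"
      using assms(2) by (metis homeomorphic_empty_space null_topspace_iff_trivial)
    then have "sphere (0::complex) 1 = {} \<or> {0..1::real} = {}"
      by (metis null_topspace_iff_trivial topspace_euclidean_subtopology)
    then show False by simp
  qed
  \<comment> \<open>Numbering the finitely many cut-points yields the distinct abscissae for the
    stubs in the complex plane.\<close>
  moreover obtain pos :: "'a \<Rightarrow> nat" where "inj_on pos (dom C)"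
    using finite_imp_inj_to_nat_seg[of "dom C"] assms(3) by (auto simp: is_cut_diagram1_def)
  then have "inj_on (\<lambda>x. real (pos x)) (dom C)" by (auto simp: inj_on_def)
  ultimately have "stubs X C (\<lambda>x. real (pos x))"
    using assms by unfold_locales
  then show ?thesis by (rule stubs.cut_concordant_empty)
qed

end
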